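(* Let $m,n\ge1$. For every marked EW-tableau $M=(T,a)\in\mathsf{MEW}_{m,n}$ there is exactly one $D\in\mathsf{LPara}_{m,n}$ with $B(D)=\phi(T)$ and $\mathsf{surp}(D)=\zeta$, where $\zeta=(\zeta_1,\dots,\zeta_{m+n-1})$ and $\zeta_i=\eta_i(T)-a_i-1$; writing $\Phi(M)$ for this $D$, the map $\Phi:\mathsf{MEW}_{m,n}\to\mathsf{LPara}_{m,n}$ is a bijection.
   Context: All tableaux are $0/1$ arrays; $T_{ij}$ is the entry in row $i$ (top to bottom), column $j$ (left to right). Labels are symbols $v_0,\dots,v_{m+n-1}$ ordered by $v_i<v_j$ iff $i<j$. EW-tableaux: $\mathsf{EW}_{m,n}$ is the set of $m\times n$ $0/1$ tableaux $T$ whose top row is all $1$s, every other row contains a $0$, and with no rows $i\ne i'$, columns $k\ne k'$ such that $T_{ik}=T_{i'k'}=0$, $T_{ik'}=T_{i'k}=1$. Rows are labelled $v_0,\dots,v_{m-1}$ top to bottom, columns $v_m,\dots,v_{m+n-1}$ left to right. An entry $x=T_{jk}$ is cornersupport if there are $j'\ne j$, $k'\ne k$ with $T_{j'k'}=1-x$ and $T_{j'k}=T_{jk'}=x$. For $1\le i\le m-1$, $\eta_i(T)$ is the number of non-cornersupport $0$s in the row labelled $v_i$; for $m\le i\le m+n-1$, $\eta_i(T)$ is the number of non-cornersupport $1$s in the column labelled $v_i$. $\mathsf{MEW}_{m,n}$ is the set of pairs $(T,a)$ with $T\in\mathsf{EW}_{m,n}$ and $a=(a_1,\dots,a_{m+n-1})$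 integers with $0\le a_i\le\eta_i(T)-1$ (equivalently, in each row $v_i$, $i\ge1$, the $(a_i+1)$-th non-cornersupport $0$ from the left is marked, and in each column $v_i$ the $(a_i+1)$-th non-cornersupport $1$ from the top is marked). Parallelogram polyomino of type $(m,n)$: an $m\times n$ $0/1$ tableau $P$ with $P_{11}=P_{mn}=1$, every row containing at least one $1$ with the $1$s of each row contiguous, and for each $2\le i\le m$: the leftmost $1$ of row $i$ is weakly right of the leftmost $1$ of row $i-1$ and weakly left of the rightmost $1$ of row $i-1$, and the rightmost $1$ of row $i$ is weakly right of that of row $i-1$. Ribbon: exactly $m+n-1$ ones. Labelled parallelogram polyomino: $(P,\ell)$ with row labels a permutation of $\{v_0,\dots,v_{m-1}\}$, top row labelled $v_0$, labels of rows whose leftmost $1$s lie in the same column increasing top to bottom; column labels a permutation of $\{v_m,\dots,v_{m+n-1}\}$, labels of columns whose topmost $1$s lie in the same row increasing left to right. $\mathsf{LPara}_{m,n}$ is the set of these and $\mathsf{LRib}_{m,n}$ the subset with ribbon $P$. The map $\phi:\mathsf{EW}_{m,n}\to\mathsf{LRib}_{m,n}$: permute the columns of $T$ (with labels) so every entry left of a $0$ is $0$, identical columns with labels increasing left to right; then permute rows so every entry above a $1$ is $1$, identical rows with labels increasing top to bottom; get $T'$ with labelling $\ell$. Let $R_{ij}=1$ iff [$T'_{ij}=1$ and ($i=m$ or $T'_{i+1,j}=0$)] or [$T'_{ij}=0$ and ($j=n$ or $T'_{i,j+1}=1$)]. Then $\phi(T)=(R,\ell)$. Bounce: $\mathrm{bounce}(P)$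 is the $0/1$ tableau whose $1$s are the cells visited by the path starting at $(1,1)$, moving right to the rightmost $1$ of the current row, then down to the lowest $1$ of the current column, alternating until reaching $(m,n)$. For $D=(P,\ell)\in\mathsf{LPara}_{m,n}$, $B(D)=(\mathrm{bounce}(P),\ell')$ where $\ell'$ gives each maximal block of consecutive rows whose leftmost $1$ in $\mathrm{bounce}(P)$ lies in the same column the same set of labels as $\ell$ gives those rows, arranged increasingly top to bottom, and each maximal block of consecutive columns whose topmost $1$ in $\mathrm{bounce}(P)$ lies in the same row the set of labels $\ell$ gives them, increasingly left to right. $\mathsf{surp}(D)=(\mathsf{surp}_1,\dots,\mathsf{surp}_{m+n-1})$: for $1\le i\le m-1$, the column index of the leftmost $1$ of the row labelled $v_i$ in $B(D)$ minus that in $D$; for $m\le i\le m+n-1$, the row index of the topmost $1$ of the column labelled $v_i$ in $B(D)$ minus that in $D$. *)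

theory Defs
  imports Main "HOL-Library.FuncSet"
begin

text \<open>
  Rows and columns are numbered from 1, and the label \<open>v\<^sub>i\<close> is represented by the number \<open>i\<close>.
  So that equality of objects is equality in HOL, an \<open>m \<times> n\<close> tableau is a function that is 0
  outside \<open>{1..m} \<times> {1..n}\<close>, and labellings and tuples are extensional functions on their index sets.
\<close>

type_synonym tableau = "nat \<Rightarrow> nat \<Rightarrow> nat"

text \<open>A tableau together with its row labelling and its column labelling.\<close>

type_synonym labelled_tableau = "tableau \<times> (nat \<Rightarrow> nat) \<times> (nat \<Rightarrow> nat)"

definition tableaux :: "nat \<Rightarrow> nat \<Rightarrow> tableau set" where
  "tableaux m n = {T. (\<forall>i\<in>{1..m}. \<forall>j\<in>{1..n}. T i j \<in> {0, 1}) \<and>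
                      (\<forall>i j. \<not> (i \<in> {1..m} \<and> j \<in> {1..n}) \<longrightarrow> T i j = 0)}"

definition row_labelling :: "nat \<Rightarrow> (nat \<Rightarrow> nat) \<Rightarrow> bool" where
  "row_labelling m r \<longleftrightarrow> bij_betw r {1..m} {0..<m} \<and> r \<in> extensional {1..m}"

definition col_labelling :: "nat \<Rightarrow> nat \<Rightarrow> (nat \<Rightarrow> nat) \<Rightarrow> bool" where
  "col_labelling m n c \<longleftrightarrow> bij_betw c {1..n} {m..<m+n} \<and> c \<in> extensional {1..n}"

definition EW :: "nat \<Rightarrow> nat \<Rightarrow> tableau set" where
  "EW m n = {T \<in> tableaux m n.
     (\<forall>j\<in>{1..n}. T 1 j = 1) \<and>
     (\<forall>i\<in>{2..m}. \<exists>j\<in>{1..n}. T i j = 0) \<and>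
     \<not> (\<exists>i\<in>{1..m}. \<exists>i'\<in>{1..m}. \<exists>k\<in>{1..n}. \<exists>k'\<in>{1..n}. i \<noteq> i' \<and> k \<noteq> k' \<and>
          T i k = 0 \<and> T i' k' = 0 \<and> T i k' = 1 \<and> T i' k = 1)}"

definition cornersupport :: "nat \<Rightarrow> nat \<Rightarrow> tableau \<Rightarrow> nat \<Rightarrow> nat \<Rightarrow> bool" where
  "cornersupport m n T j k \<longleftrightarrow>
     (\<exists>j'\<in>{1..m}. \<exists>k'\<in>{1..n}. j' \<noteq> j \<and> k' \<noteq> k \<and>
        T j' k' = 1 - T j k \<and> T j' k = T j k \<and> T j k' = T j k)"

text \<open>
  In an EW-tableau the row labelled \<open>v\<^sub>i\<close> is row \<open>i + 1\<close>, and the column labelled \<open>v\<^sub>i\<close> is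
  column \<open>i + 1 - m\<close>.
\<close>

definition eta :: "nat \<Rightarrow> nat \<Rightarrow> tableau \<Rightarrow> nat \<Rightarrow> nat" where
  "eta m n T i =
     (if i < m
      then card {k \<in> {1..n}. T (i + 1) k = 0 \<and> \<not> cornersupport m n T (i + 1) k}
      else card {j \<in> {1..m}. T j (i + 1 - m) = 1 \<and> \<not> cornersupport m n T j (i + 1 - m)})"

definition MEW :: "nat \<Rightarrow> nat \<Rightarrow> (tableau \<times> (nat \<Rightarrow> int)) set" where
  "MEW m n = {(T, a). T \<in> EW m n \<and> a \<in> extensional {1..m+n-1} \<and>
     (\<forall>i\<in>{1..m+n-1}. 0 \<le> a i \<and> a i \<le> int (eta m n T i) - 1)}"

definition zeta :: "nat \<Rightarrow> nat \<Rightarrow> tableau \<times> (nat \<Rightarrow> int) \<Rightarrow> (nat \<Rightarrow> int)" where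
  "zeta m n = (\<lambda>(T, a). \<lambda>i\<in>{1..m+n-1}. int (eta m n T i) - a i - 1)"

definition leftmost :: "nat \<Rightarrow> tableau \<Rightarrow> nat \<Rightarrow> nat" where
  "leftmost n P i = Min {j \<in> {1..n}. P i j = 1}"

definition rightmost :: "nat \<Rightarrow> tableau \<Rightarrow> nat \<Rightarrow> nat" where
  "rightmost n P i = Max {j \<in> {1..n}. P i j = 1}"

definition topmost :: "nat \<Rightarrow> tableau \<Rightarrow> nat \<Rightarrow> nat" where
  "topmost m P j = Min {i \<in> {1..m}. P i j = 1}"

definition lowest :: "nat \<Rightarrow> tableau \<Rightarrow> nat \<Rightarrow> nat" where
  "lowest m P j = Max {i \<in> {1..m}. P i j = 1}"

definition Para :: "nat \<Rightarrow> nat \<Rightarrow> tableau set" where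
  "Para m n = {P \<in> tableaux m n.
     P 1 1 = 1 \<and> P m n = 1 \<and>
     (\<forall>i\<in>{1..m}. (\<exists>j\<in>{1..n}. P i j = 1) \<and>
        (\<forall>j k l. j \<le> k \<and> k \<le> l \<and> P i j = 1 \<and> P i l = 1 \<longrightarrow> P i k = 1)) \<and>
     (\<forall>i\<in>{2..m}. leftmost n P (i - 1) \<le> leftmost n P i \<and>
        leftmost n P i \<le> rightmost n P (i - 1) \<and>
        rightmost n P (i - 1) \<le> rightmost n P i)}"

definition LPara :: "nat \<Rightarrow> nat \<Rightarrow> labelled_tableau set" where
  "LPara m n = {(P, r, c). P \<in> Para m n \<and> row_labelling m r \<and> col_labelling m n c \<and>
     r 1 = 0 \<and>
     (\<forall>i\<in>{1..m}. \<forall>i'\<in>{1..m}. i < i' \<and> leftmost n P i = leftmost n P i' \<longrightarrow> r i < r i') \<and>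
     (\<forall>j\<in>{1..n}. \<forall>j'\<in>{1..n}. j < j' \<and> topmost m P j = topmost m P j' \<longrightarrow> c j < c j')}"

definition permute_cols :: "nat \<Rightarrow> tableau \<Rightarrow> (nat \<Rightarrow> nat) \<Rightarrow> tableau" where
  "permute_cols m T c = (\<lambda>i j. T i (c j + 1 - m))"

definition permute_rows :: "tableau \<Rightarrow> (nat \<Rightarrow> nat) \<Rightarrow> tableau" where
  "permute_rows T r = (\<lambda>i j. T (r i + 1) j)"

definition cols_arranged :: "nat \<Rightarrow> nat \<Rightarrow> tableau \<Rightarrow> (nat \<Rightarrow> nat) \<Rightarrow> bool" where
  "cols_arranged m n T c \<longleftrightarrow> col_labelling m n c \<and>
     (let T' = permute_cols m T c in
        (\<forall>i\<in>{1..m}. \<forall>j\<in>{1..n}. \<forall>j'\<in>{1..n}. j' < j \<and> T' i j = 0 \<longrightarrow> T' i j' = 0) \<and>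
        (\<forall>j\<in>{1..n}. \<forall>j'\<in>{1..n}. j < j' \<and> (\<forall>i\<in>{1..m}. T' i j = T' i j') \<longrightarrow> c j < c j'))"

definition rows_arranged :: "nat \<Rightarrow> nat \<Rightarrow> tableau \<Rightarrow> (nat \<Rightarrow> nat) \<Rightarrow> bool" where
  "rows_arranged m n T r \<longleftrightarrow> row_labelling m r \<and>
     (let T' = permute_rows T r in
        (\<forall>i\<in>{1..m}. \<forall>i'\<in>{1..m}. \<forall>j\<in>{1..n}. i' < i \<and> T' i j = 1 \<longrightarrow> T' i' j = 1) \<and>
        (\<forall>i\<in>{1..m}. \<forall>i'\<in>{1..m}. i < i' \<and> (\<forall>j\<in>{1..n}. T' i j = T' i' j) \<longrightarrow> r i < r i'))"

definition border :: "nat \<Rightarrow> nat \<Rightarrow> tableau \<Rightarrow> tableau" where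
  "border m n T = (\<lambda>i j. of_bool (i \<in> {1..m} \<and> j \<in> {1..n} \<and>
     (T i j = 1 \<and> (i = m \<or> T (i + 1) j = 0) \<or>
      T i j = 0 \<and> (j = n \<or> T i (j + 1) = 1))))"

text \<open>
  On an EW-tableau the zero sets of the columns (and of the rows) form a chain under inclusion,
  so both arrangements exist and are unique.
\<close>

definition phi :: "nat \<Rightarrow> nat \<Rightarrow> tableau \<Rightarrow> labelled_tableau" where
  "phi m n T =
     (let c = (THE c. cols_arranged m n T c);
          T\<^sub>1 = permute_cols m T c;
          r = (THE r. rows_arranged m n T\<^sub>1 r)
      in (border m n (permute_rows T\<^sub>1 r), r, c))"

text \<open>
  \<open>right_from m n P i j\<close> and \<open>down_from m n P i j\<close> say that the path begins a (possibly empty)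
  rightward, respectively downward, run at the cell \<open>(i, j)\<close>. At \<open>(m, n)\<close> all further runs
  stay in place, so no explicit stopping condition is needed.
\<close>

inductive right_from :: "nat \<Rightarrow> nat \<Rightarrow> tableau \<Rightarrow> nat \<Rightarrow> nat \<Rightarrow> bool"
  and down_from :: "nat \<Rightarrow> nat \<Rightarrow> tableau \<Rightarrow> nat \<Rightarrow> nat \<Rightarrow> bool"
  for m n :: nat and P :: tableau where
  start: "right_from m n P 1 1"
| turn_down: "right_from m n P i j \<Longrightarrow> down_from m n P i (rightmost n P i)"
| turn_right: "down_from m n P i j \<Longrightarrow> right_from m n P (lowest m P j) j"

definition bounce :: "nat \<Rightarrow> nat \<Rightarrow> tableau \<Rightarrow> tableau" where
  "bounce m n P = (\<lambda>i j. of_bool (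
     (\<exists>j\<^sub>0. right_from m n P i j\<^sub>0 \<and> j\<^sub>0 \<le> j \<and> j \<le> rightmost n P i) \<or>
     (\<exists>i\<^sub>0. down_from m n P i\<^sub>0 j \<and> i\<^sub>0 \<le> i \<and> i \<le> lowest m P j)))"

text \<open>The maximal block of consecutive indices in \<open>{1..N}\<close> around \<open>i\<close> on which \<open>f\<close> is constant.\<close>

definition block :: "nat \<Rightarrow> (nat \<Rightarrow> nat) \<Rightarrow> nat \<Rightarrow> nat set" where
  "block N f i = {i' \<in> {1..N}. \<forall>k\<in>{min i i'..max i i'}. f k = f i}"

definition sort_blocks :: "nat \<Rightarrow> (nat \<Rightarrow> nat) \<Rightarrow> (nat \<Rightarrow> nat) \<Rightarrow> (nat \<Rightarrow> nat)" where
  "sort_blocks N f l =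
     (\<lambda>i\<in>{1..N}. sorted_list_of_set (l ` block N f i) ! (i - Min (block N f i)))"

definition bounce_labelled :: "nat \<Rightarrow> nat \<Rightarrow> labelled_tableau \<Rightarrow> labelled_tableau" where
  "bounce_labelled m n = (\<lambda>(P, r, c).
     (bounce m n P,
      sort_blocks m (leftmost n (bounce m n P)) r,
      sort_blocks n (topmost m (bounce m n P)) c))"

definition leftmost_at_label :: "nat \<Rightarrow> nat \<Rightarrow> labelled_tableau \<Rightarrow> nat \<Rightarrow> nat" where
  "leftmost_at_label m n = (\<lambda>(P, r, c) v. leftmost n P (inv_into {1..m} r v))"

definition topmost_at_label :: "nat \<Rightarrow> nat \<Rightarrow> labelled_tableau \<Rightarrow> nat \<Rightarrow> nat" where
  "topmost_at_label m n = (\<lambda>(P, r, c) v. topmost m P (inv_into {1..n} c v))"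

definition surp :: "nat \<Rightarrow> nat \<Rightarrow> labelled_tableau \<Rightarrow> (nat \<Rightarrow> int)" where
  "surp m n D = (\<lambda>i\<in>{1..m+n-1}.
     if i < m
     then int (leftmost_at_label m n (bounce_labelled m n D) i) - int (leftmost_at_label m n D i)
     else int (topmost_at_label m n (bounce_labelled m n D) i) - int (topmost_at_label m n D i))"

definition Phi :: "nat \<Rightarrow> nat \<Rightarrow> tableau \<times> (nat \<Rightarrow> int) \<Rightarrow> labelled_tableau" where
  "Phi m n M = (THE D. D \<in> LPara m n \<and> bounce_labelled m n D = phi m n (fst M) \<and> surp m n D = zeta m n M)"

end

theory Submission imports Defs
begin

text \<open>
  An EW-tableau is an acyclic orientation of the complete bipartite graph on rows and columns whose
  unique source is \<open>v\<^sub>0\<close>, where a 1 orients the edge from its row to its column. Such an orientation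
  is determined by the lengths \<open>\<tau> x\<close> of longest paths from the source, which are even on rows and odd on
  columns. Let \<open>cnt t\<close> be the number of labels \<open>y\<close> with \<open>\<tau> y \<le> t\<close> and \<open>\<tau> y \<equiv> t\<close> modulo 2. The
  ribbon of the tableau puts the leftmost (topmost) 1 of row (column) \<open>x\<close> at position \<open>cnt (\<tau> x - 1)\<close>,
  and a general labelled polyomino moves it back by its surplus \<open>s x\<close>, to \<open>F x = cnt (\<tau> x - 1) - s x\<close>.
  The non-cornersupport entries counted by \<open>\<eta>\<close> are those at the labels \<open>y\<close> with \<open>\<tau> y = \<tau> x - 1\<close>, so
  \<open>0 \<le> s x < \<eta> x\<close> says precisely that \<open>F x\<close> lies in the interval \<open>(cnt (\<tau> x - 3), cnt (\<tau> x - 1)]\<close>.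
  Hence \<open>F x \<le> cnt t\<close> iff \<open>\<tau> x \<le> t + 1\<close>. This makes the bounce path of the polyomino turn exactly at
  the values of \<open>cnt\<close>, which identifies the bounce ribbon with the ribbon of the tableau, and it allows
  \<open>\<tau>\<close> and \<open>s\<close> to be recovered from \<open>F\<close> layer by layer, as in Dhar's burning algorithm.
\<close>

section \<open>Sorting labels\<close>

definition lex_less :: "(nat \<Rightarrow> nat) \<Rightarrow> nat \<Rightarrow> nat \<Rightarrow> bool" where
  "lex_less f x y \<longleftrightarrow> f x < f y \<or> f x = f y \<and> x < y"

text \<open>The rows of a labelled polyomino are listed this way with \<open>f\<close> the column of
  the leftmost 1, and the arrangements in \<open>phi\<close> are of this form with \<open>f\<close>
  the level. Strictness and extensionality make the listing unique.\<close>

definition sorts :: "nat \<Rightarrow> nat set \<Rightarrow> (nat \<Rightarrow> nat) \<Rightarrow> (nat \<Rightarrow> nat) \<Rightarrow> bool" where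
  "sorts N V f r \<longleftrightarrow> bij_betw r {1..N} V \<and> r \<in> extensional {1..N} \<and>
     (\<forall>i\<in>{1..N}. \<forall>i'\<in>{1..N}. i < i' \<longrightarrow> lex_less f (r i) (r i'))"

definition sorter :: "nat \<Rightarrow> nat set \<Rightarrow> (nat \<Rightarrow> nat) \<Rightarrow> (nat \<Rightarrow> nat)" where
  "sorter N V f = (THE r. sorts N V f r)"

text \<open>The indices with value at most \<open>x\<close> form an initial segment, so its length
  decides membership: a Galois connection between a monotone sequence and its counting
  function.\<close>

lemma le_iff_le_card:
  fixes g :: "nat \<Rightarrow> nat"
  assumes "mono_on {1..N} g" and i: "i \<in> {1..N}"
  shows "g i \<le> x \<longleftrightarrow> i \<le> card {k \<in> {1..N}. g k \<le> x}"
proof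
  assume "g i \<le> x"
  moreover have "g k \<le> g i" if "k \<in> {1..i}" for k
    using i that by (intro mono_onD[OF assms(1)]) auto
  ultimately have "{1..i} \<subseteq> {k \<in> {1..N}. g k \<le> x}" using i by fastforce
  then have "card {1..i} \<le> card {k \<in> {1..N}. g k \<le> x}"
    by (intro card_mono) auto
  then show "i \<le> card {k \<in> {1..N}. g k \<le> x}" by simp
next
  assume le: "i \<le> card {k \<in> {1..N}. g k \<le> x}"
  show "g i \<le> x"
  proof (rule ccontr)
    assume gt: "\<not> g i \<le> x"
    have "k < i" if "k \<in> {1..N}" "g k \<le> x" for k
    proof (rule ccontr)
      assume "\<not> k < i"
      then have "g i \<le> g k" using i that(1) by (intro mono_onD[OF assms(1)]) auto
      then show False using gt that(2) by simp
    qed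
    then have "{k \<in> {1..N}. g k \<le> x} \<subseteq> {1..<i}" by auto
    then have "card {k \<in> {1..N}. g k \<le> x} \<le> card {1..<i}"
      by (intro card_mono) auto
    then show False using le i by (cases i) auto
  qed
qed

lemma card_le_bij:
  fixes f r :: "nat \<Rightarrow> nat"
  assumes "bij_betw r {1..N} V"
  shows "card {k \<in> {1..N}. f (r k) \<le> x} = card {v \<in> V. f v \<le> x}"
proof -
  have "{v \<in> V. f v \<le> x} = r ` {k \<in> {1..N}. f (r k) \<le> x}"
    using assms by (auto simp: bij_betw_def)
  moreover have "inj_on r {k \<in> {1..N}. f (r k) \<le> x}"
    by (rule inj_on_subset[OF bij_betw_imp_inj_on[OF assms]]) auto
  ultimately show ?thesis by (simp add: card_image)
qed

text \<open>The count runs over labels and not positions, so the right-hand side is independent of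
  the arrangement \<open>r\<close>. This is the basic translation between labels and
  positions.\<close>

lemma position_le:
  fixes f r :: "nat \<Rightarrow> nat"
  assumes "bij_betw r {1..N} V" "mono_on {1..N} (\<lambda>i. f (r i))" "i \<in> {1..N}"
  shows "f (r i) \<le> x \<longleftrightarrow> i \<le> card {v \<in> V. f v \<le> x}"
  using le_iff_le_card[OF assms(2,3), of x] card_le_bij[OF assms(1), of f x] by simp

text \<open>By \<open>position_le\<close>, every threshold comparison of the value at position
  \<open>i\<close> is decided by \<open>V\<close>, \<open>f\<close> and \<open>i\<close>
  alone.\<close>

lemma mono_rearrangement_unique:
  fixes f r r' :: "nat \<Rightarrow> nat"
  assumes "bij_betw r {1..N} V" "mono_on {1..N} (\<lambda>i. f (r i))"
    and "bij_betw r' {1..N} V" "mono_on {1..N} (\<lambda>i. f (r' i))" and "i \<in> {1..N}"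
  shows "f (r i) = f (r' i)"
  using position_le[OF assms(1,2,5)] position_le[OF assms(3,4,5)] by (metis order_antisym order_refl)

lemma sorts_mono:
  assumes "sorts N V f r"
  shows "mono_on {1..N} (\<lambda>i. f (r i))"
proof (rule mono_onI)
  fix i j assume "i \<in> {1..N}" "j \<in> {1..N}" "i \<le> j"
  then have "i = j \<or> lex_less f (r i) (r j)"
    using assms unfolding sorts_def by (metis le_neq_implies_less)
  then show "f (r i) \<le> f (r j)" by (auto simp: lex_less_def)
qed

text \<open>Value and label become the two digits of one number in base \<open>K\<close>, which
  reduces lexicographic sorting to sorting numbers.\<close>

lemma lex_key:
  fixes x y K :: nat
  assumes "x < K" "y < K"
  shows "f x * K + x < f y * K + y \<longleftrightarrow> lex_less f x y"
proof -
  have *: "f u * K + u < f v * K + v" if "f u < f v" "u < K" for u v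
  proof -
    have "Suc (f u) * K \<le> f v * K" using that by (intro mult_le_mono1) simp
    then show ?thesis using that by simp
  qed
  show ?thesis
    using *[of x y] *[of y x] assms by (cases "f x" "f y" rule: linorder_cases) (auto simp: lex_less_def)
qed

text \<open>Sort the numerical keys of \<open>lex_key\<close> and decode them by the inverse of the
  key function.\<close>

lemma sorts_exists:
  assumes "finite V" "card V = N"
  shows "\<exists>r. sorts N V f r"
proof -
  obtain K where K: "\<And>x. x \<in> V \<Longrightarrow> x < K"
    using assms(1) finite_nat_set_iff_bounded by auto
  let ?g = "\<lambda>x. f x * K + x"
  have inj: "inj_on ?g V"
  proof (rule inj_onI)
    fix x y assume "x \<in> V" "y \<in> V" "?g x = ?g y"
    then have "\<not> lex_less f x y" "\<not> lex_less f y x"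
      using lex_key[of x K y f] lex_key[of y K x f] K by auto
    then show "x = y" by (auto simp: lex_less_def)
  qed
  then have cg: "card (?g ` V) = N" using assms(2) by (simp add: card_image)
  define h where "h = (!) (sorted_list_of_set (?g ` V))"
  have len: "length (sorted_list_of_set (?g ` V)) = N" using cg by simp
  have h1: "bij_betw h {..<N} (?g ` V)"
    unfolding h_def using len assms(1) by (intro bij_betw_nth) auto
  have h2: "h i < h j" if "i < j" "j < N" for i j
    unfolding h_def using that len by (intro sorted_wrt_nth_less[OF strict_sorted_list_of_set]) auto
  \<comment> \<open>Lists are indexed from 0 and positions from 1, whence
    \<open>i - 1\<close>.\<close>
  define r where "r = restrict (\<lambda>i. inv_into V ?g (h (i - 1))) {1..N}"
  have b1: "bij_betw (\<lambda>i. i - 1) {1..N} {..<N}"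
    by (rule bij_betwI[where g = Suc]) auto
  have b2: "bij_betw (inv_into V ?g) (?g ` V) V"
    using inj by (intro bij_betw_inv_into) (simp add: bij_betw_def)
  have "bij_betw (\<lambda>i. inv_into V ?g (h (i - 1))) {1..N} V"
    using bij_betw_trans[OF bij_betw_trans[OF b1 h1] b2] by (simp add: comp_def)
  then have br: "bij_betw r {1..N} V"
    unfolding r_def using bij_betw_restrict_eq by blast
  have gr: "?g (r i) = h (i - 1)" if "i \<in> {1..N}" for i
  proof -
    have "h (i - 1) \<in> ?g ` V" using h1 that by (auto simp: bij_betw_def)
    then show ?thesis using that f_inv_into_f[of "h (i - 1)" ?g V] by (simp add: r_def)
  qed
  have "lex_less f (r i) (r i')" if "i \<in> {1..N}" "i' \<in> {1..N}" "i < i'" for i i'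
  proof -
    have "r i \<in> V" "r i' \<in> V" using br that by (auto simp: bij_betw_def)
    moreover have "h (i - 1) < h (i' - 1)"
      using that by (intro h2) auto
    ultimately show ?thesis using lex_key[of "r i" K "r i'" f] K gr that by simp
  qed
  then have "sorts N V f r" using br by (auto simp: sorts_def r_def)
  then show ?thesis by blast
qed

text \<open>Both listings are monotone in the injective key of \<open>lex_key\<close>, so
  \<open>mono_rearrangement_unique\<close> applies to that key.\<close>

lemma sorts_unique:
  assumes "sorts N V f r" "sorts N V f r'"
  shows "r = r'"
proof -
  have bij: "bij_betw r {1..N} V" "bij_betw r' {1..N} V"
    using assms by (auto simp: sorts_def)
  then have "finite V" using bij_betw_finite by blast
  then obtain K where K: "\<And>x. x \<in> V \<Longrightarrow> x < K"
    using finite_nat_set_iff_bounded by auto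
  let ?g = "\<lambda>x. f x * K + x"
  have mono: "mono_on {1..N} (\<lambda>i. ?g (s i))" if s: "sorts N V f s" for s
  proof (rule mono_onI)
    fix i j assume ij: "i \<in> {1..N}" "j \<in> {1..N}" "i \<le> j"
    have "s i \<in> V" "s j \<in> V" using s ij by (auto simp: sorts_def bij_betw_def)
    then show "?g (s i) \<le> ?g (s j)"
      using s ij lex_key[of "s i" K "s j" f] K
      by (cases "i = j") (auto simp: sorts_def intro: less_imp_le)
  qed
  have "r i = r' i" if i: "i \<in> {1..N}" for i
  proof -
    have "?g (r i) = ?g (r' i)"
      using mono_rearrangement_unique[OF bij(1) mono[OF assms(1)] bij(2) mono[OF assms(2)] i] .
    moreover have "r i \<in> V" "r' i \<in> V" using bij i by (auto simp: bij_betw_def)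
    ultimately have "\<not> lex_less f (r i) (r' i)" "\<not> lex_less f (r' i) (r i)"
      using lex_key[of "r i" K "r' i" f] lex_key[of "r' i" K "r i" f] K by auto
    then show ?thesis by (auto simp: lex_less_def)
  qed
  then show ?thesis using assms by (auto simp: sorts_def intro: extensionalityI)
qed

lemma sorter_eq: "sorts N V f r \<Longrightarrow> sorter N V f = r"
  unfolding sorter_def by (blast intro: the_equality sorts_unique)

lemma sorts_sorter: "finite V \<Longrightarrow> card V = N \<Longrightarrow> sorts N V f (sorter N V f)"
  using sorts_exists sorter_eq by metis

lemma sorts_weaken:
  assumes "sorts N V f r" "\<And>x y. x \<in> V \<Longrightarrow> y \<in> V \<Longrightarrow> lex_less f x y \<Longrightarrow> lex_less g x y"
  shows "sorts N V g r"
proof -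
  have "bij_betw r {1..N} V" using assms(1) by (simp add: sorts_def)
  then have "r i \<in> V" if "i \<in> {1..N}" for i using that by (rule bij_betw_apply)
  then show ?thesis using assms(1) unfolding sorts_def by (simp add: assms(2))
qed

lemma sorter_cong:
  assumes "\<And>x. x \<in> V \<Longrightarrow> f x = g x" "finite V" "card V = N"
  shows "sorter N V f = sorter N V g"
  by (intro sorter_eq sorts_weaken[OF sorts_sorter[OF assms(2,3), of g]])
    (simp add: lex_less_def assms(1))

text \<open>Level sets of a monotone function are intervals, so a maximal constant block is a whole
  level set.\<close>

lemma block_mono:
  assumes "mono_on {1..N} h" "i \<in> {1..N}"
  shows "block N h i = {k \<in> {1..N}. h k = h i}"
proof -
  have "h k = h i" if k: "min i k' \<le> k" "k \<le> max i k'" and k': "h k' = h i" "k' \<in> {1..N}" for k k'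
  proof (cases "i \<le> k'")
    case True
    then have k: "i \<le> k" "k \<le> k'" using k by simp_all
    then have "k \<in> {1..N}" using assms(2) k' by auto
    then show ?thesis
      using mono_onD[OF assms(1), of i k] mono_onD[OF assms(1), of k k'] k k' assms(2) by simp
  next
    case False
    then have k: "k' \<le> k" "k \<le> i" using k by simp_all
    then have "k \<in> {1..N}" using assms(2) k' by auto
    then show ?thesis
      using mono_onD[OF assms(1), of k i] mono_onD[OF assms(1), of k' k] k k' assms(2) by simp
  qed
  moreover have "k \<in> {min i k..max i k}" for k :: nat by simp
  ultimately show ?thesis unfolding block_def by (intro Collect_cong) (metis atLeastAtMost_iff)
qed

text \<open>The listing is already monotone in \<open>f\<close>, so only the order of labels inside
  each block of equal value can be wrong, and that is what sorting the blocks repairs.\<close>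

lemma sorts_sort_blocks:
  assumes bij: "bij_betw r {1..N} V" and mono: "mono_on {1..N} (\<lambda>i. f (r i))"
    and h: "\<And>i. i \<in> {1..N} \<Longrightarrow> h i = f (r i)"
  shows "sorts N V f (sort_blocks N h r)"
proof -
  have mh: "mono_on {1..N} h"
    using mono_onD[OF mono] h by (intro mono_onI) simp
  define B where "B i = {k \<in> {1..N}. h k = h i}" for i
  define g where "g = sort_blocks N h r"
  have finB: "finite (B i)" for i by (auto simp: B_def)
  have lenB: "length (sorted_list_of_set (r ` B i)) = card (B i)" for i
  proof -
    have "inj_on r (B i)" by (rule inj_on_subset[OF bij_betw_imp_inj_on[OF bij]]) (auto simp: B_def)
    then show ?thesis by (simp add: card_image)
  qed
  have geq: "g i = sorted_list_of_set (r ` B i) ! (i - Min (B i))" if "i \<in> {1..N}" for i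
    using that block_mono[OF mh that] by (simp add: g_def sort_blocks_def B_def)
  \<comment> \<open>All positions from the start of the block to \<open>i\<close> lie in the block,
    so the offset of \<open>i\<close> is a valid list index.\<close>
  have ub: "i - Min (B i) < card (B i)" "Min (B i) \<le> i" if i: "i \<in> {1..N}" for i
  proof -
    have iB: "i \<in> B i" using i by (simp add: B_def)
    then have MB: "Min (B i) \<in> B i" using finB Min_in by blast
    show le: "Min (B i) \<le> i" using iB finB by simp
    have "k \<in> B i" if k: "Min (B i) \<le> k" "k \<le> i" for k
    proof -
      have "k \<in> {1..N}" using k i MB by (auto simp: B_def)
      moreover have "Min (B i) \<in> {1..N}" using MB by (simp add: B_def)
      ultimately have "h (Min (B i)) \<le> h k" "h k \<le> h i"
        using k i mono_onD[OF mh] by blast+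
      then show ?thesis using MB \<open>k \<in> {1..N}\<close> by (auto simp: B_def)
    qed
    then have "{Min (B i)..i} \<subseteq> B i" by auto
    then have "card {Min (B i)..i} \<le> card (B i)" using finB card_mono by blast
    then show "i - Min (B i) < card (B i)" using le by simp
  qed
  have gB: "g i \<in> r ` B i" if i: "i \<in> {1..N}" for i
    using nth_mem[of "i - Min (B i)" "sorted_list_of_set (r ` B i)"] ub[OF i] lenB geq[OF i] finB by simp
  have gV: "g i \<in> V" and fg: "f (g i) = h i" if i: "i \<in> {1..N}" for i
    using gB[OF i] bij h by (auto simp: B_def bij_betw_def)
  have lex: "lex_less f (g i) (g j)" if ij: "i \<in> {1..N}" "j \<in> {1..N}" "i < j" for i j
  proof (cases "h i = h j")
    case True
    then have eq: "B i = B j" by (auto simp: B_def)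
    have "g i < g j"
      unfolding geq[OF ij(1)] geq[OF ij(2)] eq
      using ub[OF ij(1)] ub[OF ij(2)] ij eq lenB[of j]
      by (intro sorted_wrt_nth_less[OF strict_sorted_list_of_set]) auto
    then show ?thesis using True fg ij by (simp add: lex_less_def)
  next
    case False
    moreover have "h i \<le> h j" using ij mono_onD[OF mh] by simp
    ultimately show ?thesis using fg ij by (simp add: lex_less_def)
  qed
  \<comment> \<open>Strict lexicographic increase gives injectivity; surjectivity onto
    \<open>V\<close> then follows by counting.\<close>
  have "inj_on g {1..N}"
  proof (rule linorder_inj_onI)
    fix i j assume "i < j" "i \<in> {1..N}" "j \<in> {1..N}"
    then show "g i \<noteq> g j" using lex[of i j] by (auto simp: lex_less_def)
  qed auto
  moreover have "g ` {1..N} = V"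
  proof (rule card_subset_eq)
    show "finite V" using bij bij_betw_finite by blast
    show "g ` {1..N} \<subseteq> V" using gV by auto
    show "card (g ` {1..N}) = card V"
      using \<open>inj_on g {1..N}\<close> bij_betw_same_card[OF bij] by (simp add: card_image)
  qed
  ultimately show ?thesis
    using lex unfolding sorts_def g_def[symmetric]
    by (auto simp: bij_betw_def g_def sort_blocks_def)
qed

section \<open>Polyominoes from their boundary functions\<close>

text \<open>\<open>a\<close> stands for the left ends of the rows and \<open>b\<close> for the top
  ends of the columns. The description is symmetric: transposition exchanges \<open>a\<close> and
  \<open>b\<close>.\<close>

definition polyomino :: "nat \<Rightarrow> nat \<Rightarrow> (nat \<Rightarrow> nat) \<Rightarrow> (nat \<Rightarrow> nat) \<Rightarrow> tableau" where
  "polyomino m n a b = (\<lambda>i j. of_bool (i \<in> {1..m} \<and> j \<in> {1..n} \<and> a i \<le> j \<and> b j \<le> i))"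

text \<open>The last two conditions are the overlap of neighbours: the first cell of row
  \<open>Suc i\<close> has a cell of the polyomino directly above it, and the first cell of column
  \<open>Suc j\<close> has one directly to its left.\<close>

definition boundary :: "nat \<Rightarrow> nat \<Rightarrow> (nat \<Rightarrow> nat) \<Rightarrow> (nat \<Rightarrow> nat) \<Rightarrow> bool" where
  "boundary m n a b \<longleftrightarrow> 1 \<le> m \<and> 1 \<le> n \<and> (\<forall>i\<in>{1..m}. a i \<in> {1..n}) \<and> (\<forall>j\<in>{1..n}. b j \<in> {1..m}) \<and>
     mono_on {1..m} a \<and> mono_on {1..n} b \<and> a 1 = 1 \<and> b 1 = 1 \<and>
     (\<forall>i\<in>{1..<m}. b (a (Suc i)) \<le> i) \<and> (\<forall>j\<in>{1..<n}. a (b (Suc j)) \<le> j)"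

lemma polyomino_eq_1_iff:
  "polyomino m n a b i j = 1 \<longleftrightarrow> i \<in> {1..m} \<and> j \<in> {1..n} \<and> a i \<le> j \<and> b j \<le> i"
  by (simp add: polyomino_def)

lemma boundary_sym: "boundary m n a b \<Longrightarrow> boundary n m b a"
  by (auto simp: boundary_def)

lemma polyomino_transpose: "(\<lambda>j i. polyomino m n a b i j) = polyomino n m b a"
  by (auto simp: polyomino_def fun_eq_iff)

lemma polyomino_cong:
  assumes "\<And>i. i \<in> {1..m} \<Longrightarrow> a i = a' i" "\<And>j. j \<in> {1..n} \<Longrightarrow> b j = b' j"
  shows "polyomino m n a b = polyomino m n a' b'"
  using assms by (auto simp: polyomino_def fun_eq_iff)

lemma topmost_transpose: "topmost m P j = leftmost m (\<lambda>j i. P i j) j"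
  by (simp add: topmost_def leftmost_def)

lemma lowest_transpose: "lowest m P j = rightmost m (\<lambda>j i. P i j) j"
  by (simp add: lowest_def rightmost_def)

text \<open>Hence the cell \<open>(i, a i)\<close> belongs to the polyomino. Beyond row 1 this
  follows from the overlap with the previous row.\<close>

lemma boundary_left_end:
  assumes "boundary m n a b" "i \<in> {1..m}"
  shows "b (a i) \<le> i"
proof (cases "i = 1")
  case False
  then obtain k where "i = Suc k" "k \<in> {1..<m}" using assms(2) by (cases i) auto
  then show ?thesis using assms(1) by (auto simp: boundary_def le_Suc_eq)
qed (use assms in \<open>auto simp: boundary_def\<close>)

lemma leftmost_polyomino:
  assumes "boundary m n a b" "i \<in> {1..m}"
  shows "leftmost n (polyomino m n a b) i = a i"
  unfolding leftmost_def
proof (rule Min_eqI)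
  show "a i \<in> {j \<in> {1..n}. polyomino m n a b i j = 1}"
    using assms boundary_left_end[OF assms] unfolding polyomino_eq_1_iff boundary_def by simp
qed (simp_all add: polyomino_eq_1_iff del: One_nat_def)

lemma topmost_polyomino:
  assumes "boundary m n a b" "j \<in> {1..n}"
  shows "topmost m (polyomino m n a b) j = b j"
  using leftmost_polyomino[OF boundary_sym[OF assms(1)] assms(2)]
  by (simp add: topmost_transpose polyomino_transpose)

text \<open>Since \<open>b\<close> is monotone, the columns starting at or above row
  \<open>i\<close> are an initial segment, and its length is the right end of the row.\<close>

lemma rightmost_polyomino:
  assumes "boundary m n a b" "i \<in> {1..m}"
  shows "rightmost n (polyomino m n a b) i = card {j \<in> {1..n}. b j \<le> i}"
proof -
  let ?N = "card {j \<in> {1..n}. b j \<le> i}"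
  have mono: "mono_on {1..n} b" using assms by (simp add: boundary_def)
  have ai: "a i \<in> {1..n}" using assms by (auto simp: boundary_def)
  have "a i \<le> ?N"
    using le_iff_le_card[OF mono ai, of i] boundary_left_end[OF assms] by simp
  moreover have "?N \<le> card {1..n}" by (intro card_mono) auto
  ultimately have N: "?N \<in> {1..n}" "a i \<le> ?N" using ai by auto
  show ?thesis
    unfolding rightmost_def
  proof (rule Max_eqI)
    show "?N \<in> {j \<in> {1..n}. polyomino m n a b i j = 1}"
      using N assms(2) le_iff_le_card[OF mono N(1), of i] unfolding polyomino_eq_1_iff by simp
    fix j assume "j \<in> {j \<in> {1..n}. polyomino m n a b i j = 1}"
    then show "j \<le> ?N" using le_iff_le_card[OF mono, of j i] unfolding polyomino_eq_1_iff by simp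
  qed simp
qed

lemma lowest_polyomino:
  assumes "boundary m n a b" "j \<in> {1..n}"
  shows "lowest m (polyomino m n a b) j = card {i \<in> {1..m}. a i \<le> j}"
  using rightmost_polyomino[OF boundary_sym[OF assms(1)] assms(2)]
  by (simp add: lowest_transpose polyomino_transpose)

lemma polyomino_in_Para:
  assumes bd: "boundary m n a b"
  shows "polyomino m n a b \<in> Para m n"
proof -
  have mono: "mono_on {1..n} b" and mona: "mono_on {1..m} a" using bd by (auto simp: boundary_def)
  have last: "a m \<le> n" "b n \<le> m" "1 \<le> m" "1 \<le> n" "a 1 = 1" "b 1 = 1" using bd by (auto simp: boundary_def)
  have ex: "\<exists>j\<in>{1..n}. polyomino m n a b i j = 1" if "i \<in> {1..m}" for i
    using that bd boundary_left_end[OF bd that] unfolding polyomino_eq_1_iff boundary_def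
    by (intro bexI[of _ "a i"]) simp_all
  have conv: "polyomino m n a b i k = 1"
    if "j \<le> k" "k \<le> l" "polyomino m n a b i j = 1" "polyomino m n a b i l = 1" for i j k l
  proof -
    have kl: "k \<in> {1..n}" "l \<in> {1..n}" using that unfolding polyomino_eq_1_iff by auto
    then have "b k \<le> b l" using mono_onD[OF mono] that by blast
    then show ?thesis using that kl unfolding polyomino_eq_1_iff by simp
  qed
  have step: "leftmost n (polyomino m n a b) (i - 1) \<le> leftmost n (polyomino m n a b) i \<and>
        leftmost n (polyomino m n a b) i \<le> rightmost n (polyomino m n a b) (i - 1) \<and>
        rightmost n (polyomino m n a b) (i - 1) \<le> rightmost n (polyomino m n a b) i"
    if i: "i \<in> {2..m}" for i
  proof -
    have i1: "i \<in> {1..m}" "i - 1 \<in> {1..m}" "i - 1 \<in> {1..<m}" "Suc (i - 1) = i" using i by auto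
    have ai: "a i \<in> {1..n}" using bd i1(1) unfolding boundary_def by blast
    \<comment> \<open>Overlap of rows, turned by \<open>le_iff_le_card\<close> into the bound of
      \<open>a i\<close> by the right end of row \<open>i - 1\<close>.\<close>
    have "b (a i) \<le> i - 1" using bd i1(3,4) unfolding boundary_def by metis
    then have "a i \<le> card {j \<in> {1..n}. b j \<le> i - 1}"
      using le_iff_le_card[OF mono ai, of "i - 1"] by simp
    moreover have "a (i - 1) \<le> a i" using i1 by (intro mono_onD[OF mona]) auto
    moreover have "card {j \<in> {1..n}. b j \<le> i - 1} \<le> card {j \<in> {1..n}. b j \<le> i}"
      by (intro card_mono) auto
    ultimately show ?thesis
      using leftmost_polyomino[OF bd i1(1)] leftmost_polyomino[OF bd i1(2)]
        rightmost_polyomino[OF bd i1(1)] rightmost_polyomino[OF bd i1(2)] by simp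
  qed
  show ?thesis
    unfolding Para_def mem_Collect_eq
  proof (intro conjI ballI allI impI)
    show "polyomino m n a b \<in> tableaux m n" by (auto simp: tableaux_def polyomino_def)
    show "polyomino m n a b 1 1 = 1" "polyomino m n a b m n = 1"
      unfolding polyomino_eq_1_iff using last by simp_all
  qed (use ex conv step in blast)+
qed

lemma tableaux_nonzero:
  assumes "T \<in> tableaux m n" "T i j \<noteq> 0"
  shows "i \<in> {1..m} \<and> j \<in> {1..n} \<and> T i j = 1"
proof -
  have "\<forall>i j. \<not> (i \<in> {1..m} \<and> j \<in> {1..n}) \<longrightarrow> T i j = 0"
    using assms(1) unfolding tableaux_def mem_Collect_eq by (rule conjunct2)
  then have ij: "i \<in> {1..m}" "j \<in> {1..n}" using assms(2) by metis+
  then have "T i j \<in> {0, 1}" using assms(1) by (simp add: tableaux_def)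
  then show ?thesis using ij assms(2) by simp
qed

text \<open>Each row is an interval with weakly increasing ends, and the top of a column is the
  first row whose right end reaches it. Thus the right ends can be replaced by the top ends.\<close>

lemma Para_boundary:
  assumes "P \<in> Para m n" "1 \<le> m" "1 \<le> n"
  shows "boundary m n (leftmost n P) (topmost m P)"
    and "P = polyomino m n (leftmost n P) (topmost m P)"
proof -
  let ?a = "leftmost n P" and ?e = "rightmost n P" and ?b = "topmost m P"
  have P: "P \<in> tableaux m n" and P11: "P 1 1 = 1" and Pmn: "P m n = 1"
    and rows: "\<forall>i\<in>{1..m}. (\<exists>j\<in>{1..n}. P i j = 1) \<and>
        (\<forall>j k l. j \<le> k \<and> k \<le> l \<and> P i j = 1 \<and> P i l = 1 \<longrightarrow> P i k = 1)"
    and steps: "\<forall>i\<in>{2..m}. ?a (i - 1) \<le> ?a i \<and> ?a i \<le> ?e (i - 1) \<and> ?e (i - 1) \<le> ?e i"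
    using assms(1) unfolding Para_def mem_Collect_eq by - (elim conjE, assumption)+
  have tab: "i \<in> {1..m} \<and> j \<in> {1..n} \<and> P i j = 1" if "P i j \<noteq> 0" for i j
    using tableaux_nonzero[OF P that] .
  have ne: "\<exists>j\<in>{1..n}. P i j = 1" if "i \<in> {1..m}" for i
    using rows that by blast
  have conv: "P i k = 1" if "i \<in> {1..m}" "j \<le> k" "k \<le> l" "P i j = 1" "P i l = 1" for i j k l
    using rows that by blast
  have aP: "?a i \<in> {1..n} \<and> P i (?a i) = 1" and eP: "?e i \<in> {1..n} \<and> P i (?e i) = 1"
    if i: "i \<in> {1..m}" for i
  proof -
    have "?a i \<in> {j \<in> {1..n}. P i j = 1}" unfolding leftmost_def using ne[OF i] by (intro Min_in) auto
    then show "?a i \<in> {1..n} \<and> P i (?a i) = 1" by simp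
    have "?e i \<in> {j \<in> {1..n}. P i j = 1}" unfolding rightmost_def using ne[OF i] by (intro Max_in) auto
    then show "?e i \<in> {1..n} \<and> P i (?e i) = 1" by simp
  qed
  have Piff: "P i j = 1 \<longleftrightarrow> ?a i \<le> j \<and> j \<le> ?e i" if i: "i \<in> {1..m}" for i j
  proof
    assume "P i j = 1"
    then have "j \<in> {j \<in> {1..n}. P i j = 1}" using tab[of i j] by simp
    then show "?a i \<le> j \<and> j \<le> ?e i" by (auto simp: leftmost_def rightmost_def)
  next
    assume "?a i \<le> j \<and> j \<le> ?e i"
    then show "P i j = 1" using conv[OF i, of "?a i" j "?e i"] aP[OF i] eP[OF i] by simp
  qed
  have suc: "?a i \<le> ?a (Suc i) \<and> ?a (Suc i) \<le> ?e i \<and> ?e i \<le> ?e (Suc i)" if "i \<in> {1..<m}" for i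
    using bspec[OF steps, of "Suc i"] that by simp
  have mono: "?a i \<le> ?a j \<and> ?e i \<le> ?e j" if "i \<le> j" "i \<in> {1..m}" "j \<in> {1..m}" for i j
    using that
  proof (induction rule: dec_induct)
    case (step k)
    then have "k \<in> {1..m}" "k \<in> {1..<m}" by auto
    then show ?case using step suc[of k] by simp
  qed simp
  have a1: "?a 1 = 1" using Piff[of 1 1] P11 aP[of 1] assms by auto
  have em: "?e m = n" using Piff[of m n] Pmn eP[of m] assms by auto
  have bL: "?b j \<in> {1..m} \<and> j \<le> ?e (?b j) \<and> (\<forall>i\<in>{1..m}. j \<le> ?e i \<longrightarrow> ?b j \<le> i)
      \<and> (?b j = 1 \<or> ?a (?b j) < j)" if j: "j \<in> {1..n}" for j
  proof -
    \<comment> \<open>This row does contain column \<open>j\<close>: beyond row 1, its left end is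
      at most the right end of the previous row, which by minimality is less than \<open>j\<close>.
      The strict inequality also yields the overlap of columns.\<close>
    define i where "i = (LEAST i. i \<in> {1..m} \<and> j \<le> ?e i)"
    have i: "i \<in> {1..m} \<and> j \<le> ?e i"
      unfolding i_def by (rule LeastI[of _ m]) (use em j assms in auto)
    have least: "i \<le> k" if "k \<in> {1..m}" "j \<le> ?e k" for k
      unfolding i_def by (rule Least_le) (use that in auto)
    have lt: "i = 1 \<or> ?a i < j"
    proof (cases "i = 1")
      case False
      then obtain k where k: "i = Suc k" "k \<in> {1..<m}" using i by (cases i) auto
      then have "\<not> j \<le> ?e k" using least[of k] by auto
      then show ?thesis using suc[of k] k by auto
    qed simp
    then have "P i j = 1" using Piff i j a1 by auto
    then have "?b j = i"
      unfolding topmost_def using i least Piff by (intro Min_eqI) auto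
    then show ?thesis using i least lt by auto
  qed
  have eq: "P i j = polyomino m n ?a ?b i j" for i j
  proof (cases "i \<in> {1..m} \<and> j \<in> {1..n}")
    case True
    \<comment> \<open>The right ends increase, so reaching column \<open>j\<close> means lying at or
      below its top.\<close>
    have "j \<le> ?e i \<longleftrightarrow> ?b j \<le> i"
      using bL[of j] mono[of "?b j" i] True by (meson order_trans)
    then have "P i j = 1 \<longleftrightarrow> polyomino m n ?a ?b i j = 1"
      using Piff[of i j] True unfolding polyomino_eq_1_iff by simp
    then show ?thesis using tab[of i j] True by (auto simp: polyomino_def)
  next
    case False
    then show ?thesis using tab[of i j] by (auto simp: polyomino_def)
  qed
  show "P = polyomino m n ?a ?b" using eq by (simp add: fun_eq_iff)
  have monb: "?b j \<le> ?b j'" if "j \<in> {1..n}" "j' \<in> {1..n}" "j \<le> j'" for j j'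
    using bL[OF that(1)] bL[OF that(2)] that(3) order_trans by blast
  have b1: "?b 1 = 1" using bL[of 1] assms eP[of 1] by force
  have ba: "?b (?a (Suc i)) \<le> i" if "i \<in> {1..<m}" for i
    using bL[of "?a (Suc i)"] aP[of "Suc i"] suc[OF that] that by simp
  have ab: "?a (?b (Suc j)) \<le> j" if "j \<in> {1..<n}" for j
    using bL[of "Suc j"] a1 that by auto
  show "boundary m n ?a ?b"
    unfolding boundary_def
  proof (intro conjI ballI mono_onI)
  qed (use assms aP bL mono monb a1 b1 ba ab in blast)+
qed

text \<open>A labelled polyomino is encoded by one function on labels, the position of the leftmost
  or topmost 1. Questions about labelled polyominoes become questions about such functions.\<close>

definition assemble :: "nat \<Rightarrow> nat \<Rightarrow> (nat \<Rightarrow> nat) \<Rightarrow> labelled_tableau" where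
  "assemble m n F =
     (let r = sorter m {0..<m} F; c = sorter n {m..<m+n} F
      in (polyomino m n (\<lambda>i. F (r i)) (\<lambda>j. F (c j)), r, c))"

section \<open>Layerings\<close>

text \<open>The possible predecessors of \<open>x\<close> on a longest path from the source;
  \<open>eta_eq_layer\<close> identifies their number with \<open>eta\<close>.\<close>

definition layer :: "nat \<Rightarrow> (nat \<Rightarrow> nat) \<Rightarrow> nat \<Rightarrow> nat" where
  "layer N \<tau> x = card {y. y < N \<and> Suc (\<tau> y) = \<tau> x}"

definition ew_tableau :: "nat \<Rightarrow> nat \<Rightarrow> (nat \<Rightarrow> nat) \<Rightarrow> tableau" where
  "ew_tableau m n \<tau> = (\<lambda>i j. of_bool (i \<in> {1..m} \<and> j \<in> {1..n} \<and> \<tau> (i - 1) < \<tau> (j + m - 1)))"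

text \<open>
  \<open>\<tau> x\<close> is the length of a longest directed path from the source \<open>v\<^sub>0\<close> to \<open>v\<^sub>x\<close> in the acyclic
  orientation of the complete bipartite graph on rows and columns encoded by the tableau.
\<close>

locale layering =
  fixes m n :: nat and \<tau> :: "nat \<Rightarrow> nat"
  assumes m_pos: "1 \<le> m" and n_pos: "1 \<le> n"
    and parity: "\<And>x. x < m + n \<Longrightarrow> even (\<tau> x) \<longleftrightarrow> x < m"
    and zero_iff: "\<And>x. x < m + n \<Longrightarrow> \<tau> x = 0 \<longleftrightarrow> x = 0"
    and pred: "\<And>x. x < m + n \<Longrightarrow> x \<noteq> 0 \<Longrightarrow> \<exists>y < m + n. Suc (\<tau> y) = \<tau> x"
begin

section \<open>Counting labels by level and parity\<close>

definition cnt :: "nat \<Rightarrow> nat" where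
  "cnt t = card {y. y < m + n \<and> \<tau> y \<le> t \<and> even (\<tau> y) = even t}"

lemma tau_0: "\<tau> 0 = 0"
  by (rule zero_iff[THEN iffD2]) (use m_pos in simp_all)

lemma cnt_0: "cnt 0 = 1"
proof -
  have "{y. y < m + n \<and> \<tau> y \<le> 0 \<and> even (\<tau> y) = even 0} = {0}"
    using zero_iff m_pos by (auto simp: tau_0)
  then show ?thesis by (simp add: cnt_def)
qed

lemma cnt_step: "cnt (Suc (Suc t)) = cnt t + card {y. y < m + n \<and> \<tau> y = Suc (Suc t)}"
proof -
  have "{y. y < m + n \<and> \<tau> y \<le> Suc (Suc t) \<and> even (\<tau> y) = even (Suc (Suc t))}
      = {y. y < m + n \<and> \<tau> y \<le> t \<and> even (\<tau> y) = even t} \<union> {y. y < m + n \<and> \<tau> y = Suc (Suc t)}"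
    by (auto simp: le_Suc_eq)
  then show ?thesis unfolding cnt_def by (simp add: card_Un_disjoint disjoint_iff)
qed

lemma cnt_mono:
  assumes "s \<le> t" "even s = even t"
  shows "cnt s \<le> cnt t"
  unfolding cnt_def using assms by (intro card_mono) auto

text \<open>Descending along predecessors lowers the level by exactly one, so no level is
  skipped.\<close>

lemma tau_occurs:
  assumes "x < m + n" "t \<le> \<tau> x"
  shows "\<exists>y < m + n. \<tau> y = t"
  using assms
proof (induction "\<tau> x - t" arbitrary: x)
  case 0
  then show ?case by auto
next
  case (Suc d)
  then have "x \<noteq> 0" using tau_0 by (metis diff_0_eq_0 nat.distinct(1))
  then obtain y where y: "y < m + n" "Suc (\<tau> y) = \<tau> x" using pred Suc.prems by blast
  show ?case by (rule Suc.hyps(1)[of y]) (use y Suc in auto)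
qed

lemma cnt_1: "1 \<le> cnt 1"
proof -
  have "odd (\<tau> m)" using parity[of m] n_pos by simp
  then have "1 \<le> \<tau> m" by (cases "\<tau> m") auto
  then obtain y where "y < m + n" "\<tau> y = 1" using tau_occurs[of m 1] n_pos by auto
  then have "y \<in> {y. y < m + n \<and> \<tau> y \<le> 1 \<and> even (\<tau> y) = even (1::nat)}" by simp
  then have "0 < card {y. y < m + n \<and> \<tau> y \<le> 1 \<and> even (\<tau> y) = even (1::nat)}"
    by (subst card_gt_0_iff) auto
  then show ?thesis by (simp add: cnt_def)
qed

lemma cnt_pos: "1 \<le> cnt t"
  using cnt_mono[of "t mod 2" t] cnt_0 cnt_1 by (cases "even t") (auto simp: odd_iff_mod_2_eq_one)

lemma cnt_strict:
  assumes x: "x < m + n" and "s < \<tau> x" "even s = even (\<tau> x)"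
  shows "cnt s < cnt (\<tau> x)"
  unfolding cnt_def
proof (rule psubset_card_mono)
  have "x \<notin> {y. y < m + n \<and> \<tau> y \<le> s \<and> even (\<tau> y) = even s}"
    "x \<in> {y. y < m + n \<and> \<tau> y \<le> \<tau> x \<and> even (\<tau> y) = even (\<tau> x)}"
    using assms by auto
  moreover have "{y. y < m + n \<and> \<tau> y \<le> s \<and> even (\<tau> y) = even s} \<subseteq>
      {y. y < m + n \<and> \<tau> y \<le> \<tau> x \<and> even (\<tau> y) = even (\<tau> x)}"
    using assms by auto
  ultimately show "{y. y < m + n \<and> \<tau> y \<le> s \<and> even (\<tau> y) = even s} \<subset>
      {y. y < m + n \<and> \<tau> y \<le> \<tau> x \<and> even (\<tau> y) = even (\<tau> x)}" by blast
qed simp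

lemma cnt_even: "even t \<Longrightarrow> cnt t = card {v \<in> {0..<m}. \<tau> v \<le> t}"
proof -
  assume "even t"
  then have "{y. y < m + n \<and> \<tau> y \<le> t \<and> even (\<tau> y) = even t} = {v \<in> {0..<m}. \<tau> v \<le> t}"
    using parity by auto
  then show ?thesis by (simp add: cnt_def)
qed

lemma cnt_odd: "odd t \<Longrightarrow> cnt t = card {w \<in> {m..<m+n}. \<tau> w \<le> t}"
proof -
  assume "odd t"
  then have "{y. y < m + n \<and> \<tau> y \<le> t \<and> even (\<tau> y) = even t} = {w \<in> {m..<m+n}. \<tau> w \<le> t}"
    using parity by auto
  then show ?thesis by (simp add: cnt_def)
qed

lemma cnt_even_le: "even t \<Longrightarrow> cnt t \<le> m"
proof -
  have "card {v \<in> {0..<m}. \<tau> v \<le> t} \<le> card {0..<m}" by (intro card_mono) auto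
  then show "even t \<Longrightarrow> cnt t \<le> m" by (simp add: cnt_even)
qed

lemma cnt_odd_le: "odd t \<Longrightarrow> cnt t \<le> n"
proof -
  have "card {w \<in> {m..<m+n}. \<tau> w \<le> t} \<le> card {m..<m+n}" by (intro card_mono) auto
  then show "odd t \<Longrightarrow> cnt t \<le> n" by (simp add: cnt_odd)
qed

text \<open>
  \<open>F s x\<close> is the column of the leftmost 1 of row \<open>v\<^sub>x\<close>, respectively the row of the topmost 1 of
  column \<open>v\<^sub>x\<close>, of the polyomino with surplus \<open>s\<close>. Truncated subtraction gives \<open>F s 0 = cnt 0 = 1\<close>.
\<close>

definition F :: "(nat \<Rightarrow> nat) \<Rightarrow> nat \<Rightarrow> nat" where
  "F s x = cnt (\<tau> x - 1) - s x"

text \<open>The layer of label 0 is empty, so no strict bound can hold there; its surplus is fixed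
  to 0 instead.\<close>

definition admissible :: "(nat \<Rightarrow> nat) \<Rightarrow> bool" where
  "admissible s \<longleftrightarrow> s 0 = 0 \<and> (\<forall>x < m + n. x \<noteq> 0 \<longrightarrow> s x < layer (m + n) \<tau> x)"

lemma layer_pos: "x < m + n \<Longrightarrow> x \<noteq> 0 \<Longrightarrow> 0 < layer (m + n) \<tau> x"
  using pred[of x] unfolding layer_def by (subst card_gt_0_iff) auto

lemma admissible_0: "admissible (\<lambda>_. 0)"
  using layer_pos by (simp add: admissible_def)

lemma F_0: "admissible s \<Longrightarrow> F s 0 = 1"
  by (simp add: F_def tau_0 cnt_0 admissible_def)

text \<open>The layer of \<open>x\<close> is level \<open>\<tau> x - 1\<close>, and for
  \<open>\<tau> x\<close> at least 3 its size is the increment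
  \<open>cnt (\<tau> x - 1) - cnt (\<tau> x - 3)\<close>. Subtracting less than this stays above
  \<open>cnt (\<tau> x - 3)\<close>.\<close>

lemma surplus_bound:
  assumes "admissible s" "x < m + n" "x \<noteq> 0"
  shows "s x < cnt (\<tau> x - 1)"
    and "Suc (Suc t) < \<tau> x \<Longrightarrow> even t \<noteq> even (\<tau> x) \<Longrightarrow> cnt t < F s x"
proof -
  obtain y where y: "y < m + n" "Suc (\<tau> y) = \<tau> x" using pred assms by blast
  have s: "s x < layer (m + n) \<tau> x" using assms by (simp add: admissible_def)
  have L: "layer (m + n) \<tau> x = card {z. z < m + n \<and> \<tau> z = \<tau> y}"
    unfolding layer_def y(2)[symmetric] by simp
  also have "\<dots> \<le> cnt (\<tau> y)"
    unfolding cnt_def by (intro card_mono) auto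
  finally show *: "s x < cnt (\<tau> x - 1)" using s y(2)[symmetric] by simp
  assume t: "Suc (Suc t) < \<tau> x" "even t \<noteq> even (\<tau> x)"
  then obtain u where u: "\<tau> y = Suc (Suc u)" using y by (cases "\<tau> y"; cases "\<tau> y - 1") auto
  have "t \<le> u" "even t = even u" using t u y(2)[symmetric] by auto
  then have "cnt t \<le> cnt u" by (rule cnt_mono)
  then show "cnt t < F s x"
    using cnt_step[of u] s L u y(2)[symmetric] by (simp add: F_def)
qed

lemma F_pos:
  assumes "admissible s" "x < m + n"
  shows "1 \<le> F s x"
proof (cases "x = 0")
  case False
  then show ?thesis using surplus_bound(1)[OF assms] by (simp add: F_def)
qed (use F_0[OF assms(1)] in simp)

text \<open>One direction is monotonicity of \<open>cnt\<close>. For the other, parity excludes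
  level \<open>t + 2\<close>, so a level beyond \<open>t + 1\<close> is at least
  \<open>t + 3\<close>, where \<open>surplus_bound\<close> applies.\<close>

lemma F_le_cnt_iff:
  assumes "admissible s" "x < m + n" "even t \<noteq> even (\<tau> x)"
  shows "F s x \<le> cnt t \<longleftrightarrow> \<tau> x \<le> Suc t"
proof
  assume le: "\<tau> x \<le> Suc t"
  show "F s x \<le> cnt t"
  proof (cases "x = 0")
    case True
    then show ?thesis using F_0[OF assms(1)] cnt_pos by simp
  next
    case False
    then have "\<tau> x \<noteq> 0" using zero_iff assms by simp
    then have "\<tau> x - 1 \<le> t" "even (\<tau> x - 1) = even t" using le assms(3) by auto
    then have "cnt (\<tau> x - 1) \<le> cnt t" by (rule cnt_mono)
    then show ?thesis by (simp add: F_def)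
  qed
next
  assume le: "F s x \<le> cnt t"
  show "\<tau> x \<le> Suc t"
  proof (rule ccontr)
    assume "\<not> \<tau> x \<le> Suc t"
    moreover from this have "\<tau> x \<noteq> Suc (Suc t)" using assms(3) by auto
    ultimately have "Suc (Suc t) < \<tau> x" by simp
    moreover from this have "x \<noteq> 0" using tau_0 by (metis not_less_zero)
    ultimately show False using surplus_bound(2)[OF assms(1,2)] assms(3) le by fastforce
  qed
qed

lemma F_even_le:
  assumes "admissible s" "x < m"
  shows "F s x \<in> {1..n}"
proof -
  \<comment> \<open>The level \<open>Suc (\<tau> x)\<close> is odd also for \<open>x = 0\<close>,
    where \<open>\<tau> x - 1\<close> would be truncated to an even one.\<close>
  have "F s x \<le> cnt (Suc (\<tau> x))"
    using assms parity[of x] by (subst F_le_cnt_iff) auto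
  also have "\<dots> \<le> n" using assms parity[of x] by (intro cnt_odd_le) auto
  finally show ?thesis using F_pos[OF assms(1), of x] assms(2) by simp
qed

lemma F_odd_le:
  assumes "admissible s" "x \<in> {m..<m+n}"
  shows "F s x \<in> {1..m}"
proof -
  have "F s x \<le> cnt (Suc (\<tau> x))"
    using assms parity[of x] by (subst F_le_cnt_iff) auto
  also have "\<dots> \<le> m" using assms parity[of x] by (intro cnt_even_le) auto
  finally show ?thesis using F_pos[OF assms(1), of x] assms(2) by simp
qed

text \<open>Different levels of one parity have disjoint intervals of positions. Label 0 is excluded
  because its position 1 may be shared by rows of level 2.\<close>

lemma F_less:
  assumes "admissible s" "x < m + n" "y < m + n" "even (\<tau> x) = even (\<tau> y)" "\<tau> x < \<tau> y" "x \<noteq> 0"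
  shows "F s x < F s y"
proof -
  have "\<tau> x \<noteq> 0" using zero_iff assms by simp
  then have "F s x \<le> cnt (\<tau> x - 1)" "\<not> F s y \<le> cnt (\<tau> x - 1)"
    using assms by (auto simp: F_le_cnt_iff)
  then show ?thesis by simp
qed

text \<open>The only possible tie between levels is with label 0, and being the smallest label it
  comes first in that tie.\<close>

lemma tau_le_of_lex:
  assumes "admissible s" "x < m + n" "y < m + n" "even (\<tau> x) = even (\<tau> y)" "lex_less (F s) x y"
  shows "\<tau> x \<le> \<tau> y"
proof (rule ccontr)
  assume "\<not> \<tau> x \<le> \<tau> y"
  then have *: "\<tau> y < \<tau> x" by simp
  show False
  proof (cases "y = 0")
    case True
    then show ?thesis
      using assms(5) F_0[OF assms(1)] F_pos[OF assms(1,2)] by (auto simp: lex_less_def)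
  next
    case False
    then show ?thesis using F_less[OF assms(1,3,2) _ * False] assms(4,5) by (auto simp: lex_less_def)
  qed
qed

text \<open>Without surplus, labels of one level share one position, so sorting by level also sorts
  by position; ties with label 0 are broken in its favour.\<close>

lemma lex_F0_of_lex:
  assumes "x < m + n" "y < m + n" "even (\<tau> x) = even (\<tau> y)" "lex_less \<tau> x y"
  shows "lex_less (F (\<lambda>_. 0)) x y"
proof (cases "x = 0")
  case True
  then show ?thesis
    using F_0[OF admissible_0] F_pos[OF admissible_0 assms(2)] assms(4)
    by (cases "y = 0") (auto simp: lex_less_def)
next
  case False
  show ?thesis
  proof (cases "\<tau> x = \<tau> y")
    case True
    then show ?thesis using assms(4) by (simp add: lex_less_def F_def)
  next
    case ne: False
    then have "\<tau> x < \<tau> y" using assms(4) by (simp add: lex_less_def)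
    then show ?thesis using F_less[OF admissible_0 assms(1-3) _ False] by (simp add: lex_less_def)
  qed
qed

lemma parity_sides: "x < m \<Longrightarrow> even (\<tau> x)" "x \<in> {m..<m+n} \<Longrightarrow> odd (\<tau> x)"
  using parity[of x] by auto

lemma pred_row:
  assumes "x < m" "x \<noteq> 0"
  shows "\<exists>y \<in> {m..<m+n}. Suc (\<tau> y) = \<tau> x"
proof -
  obtain y where "y < m + n" "Suc (\<tau> y) = \<tau> x" using pred[of x] assms by auto
  moreover from this have "odd (\<tau> y)" using parity_sides(1)[OF assms(1)] by (metis even_Suc)
  ultimately show ?thesis using parity[of y] by auto
qed

lemma pred_col:
  assumes "x \<in> {m..<m+n}"
  shows "\<exists>y<m. Suc (\<tau> y) = \<tau> x"
proof -
  have "x < m + n" "x \<noteq> 0" using assms m_pos by auto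
  then obtain y where "y < m + n" "Suc (\<tau> y) = \<tau> x" using pred[of x] by blast
  moreover from this have "even (\<tau> y)" using parity_sides(2)[OF assms] by (metis even_Suc)
  ultimately show ?thesis using parity[of y] by auto
qed

abbreviation "F0 \<equiv> F (\<lambda>_. 0)"

lemma sorts_F0:
  assumes "sorts N V \<tau> r" "V = {0..<m} \<or> V = {m..<m+n}"
  shows "sorts N V F0 r"
proof (rule sorts_weaken[OF assms(1)])
  fix x y assume *: "x \<in> V" "y \<in> V" "lex_less \<tau> x y"
  then have "x < m + n" "y < m + n" using assms(2) by auto
  moreover from this have "even (\<tau> x) = even (\<tau> y)" using * assms(2) parity by auto
  ultimately show "lex_less F0 x y" using lex_F0_of_lex * by blast
qed

section \<open>The ribbon of an EW-tableau\<close>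

lemma ew_tableau_cols:
  assumes "c \<in> {1..n} \<rightarrow> {m..<m+n}" "i \<in> {1..m}" "j \<in> {1..n}"
  shows "permute_cols m (ew_tableau m n \<tau>) c i j = of_bool (\<tau> (i - 1) < \<tau> (c j))"
proof -
  have "m \<le> c j" "c j < m + n" using assms by auto
  then show ?thesis using assms(2) by (auto simp: permute_cols_def ew_tableau_def Suc_diff_le)
qed

lemma ew_tableau_rows_cols:
  assumes "r \<in> {1..m} \<rightarrow> {0..<m}" "c \<in> {1..n} \<rightarrow> {m..<m+n}" "i \<in> {1..m}" "j \<in> {1..n}"
  shows "permute_rows (permute_cols m (ew_tableau m n \<tau>) c) r i j = of_bool (\<tau> (r i) < \<tau> (c j))"
proof -
  have "r i < m" using assms by auto
  then show ?thesis using ew_tableau_cols[OF assms(2), of "r i + 1" j] assms(4)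
    by (simp add: permute_rows_def)
qed

text \<open>A column has its 1s in the rows of lower level, so zeros propagate to the left iff
  levels increase; columns are identical iff their levels agree, because a row one level below a
  column separates it from all columns of lower level.\<close>

lemma cols_arranged_iff:
  "cols_arranged m n (ew_tableau m n \<tau>) c \<longleftrightarrow> sorts n {m..<m+n} \<tau> c"
proof -
  let ?T = "permute_cols m (ew_tableau m n \<tau>) c"
  have "((\<forall>i\<in>{1..m}. \<forall>j\<in>{1..n}. \<forall>j'\<in>{1..n}. j' < j \<and> ?T i j = 0 \<longrightarrow> ?T i j' = 0) \<and>
        (\<forall>j\<in>{1..n}. \<forall>j'\<in>{1..n}. j < j' \<and> (\<forall>i\<in>{1..m}. ?T i j = ?T i j') \<longrightarrow> c j < c j')) \<longleftrightarrow>
        (\<forall>j\<in>{1..n}. \<forall>j'\<in>{1..n}. j < j' \<longrightarrow> lex_less \<tau> (c j) (c j'))" (is "?L1 \<and> ?L2 \<longleftrightarrow> ?R")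
    if bij: "bij_betw c {1..n} {m..<m+n}"
  proof -
    have c: "c \<in> {1..n} \<rightarrow> {m..<m+n}" using bij by (auto simp: bij_betw_def)
    have T: "?T i j = of_bool (\<tau> (i - 1) < \<tau> (c j))" if "i \<in> {1..m}" "j \<in> {1..n}" for i j
      using ew_tableau_cols[OF c that] .
    show ?thesis
    proof
      assume L: "?L1 \<and> ?L2"
      show ?R
      proof (intro ballI impI)
        fix j j' assume j: "j \<in> {1..n}" "j' \<in> {1..n}" "j < j'"
        have "\<tau> (c j) \<le> \<tau> (c j')"
        proof (rule ccontr)
          assume "\<not> \<tau> (c j) \<le> \<tau> (c j')"
          \<comment> \<open>A row one level below column \<open>c j\<close> has a 1 there but a 0 in
            the column of lower level to the right.\<close>
          moreover obtain y where y: "y < m" "Suc (\<tau> y) = \<tau> (c j)" using pred_col c j(1) by blast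
          ultimately have "\<not> \<tau> y < \<tau> (c j')" by simp
          moreover have Sy: "Suc y \<in> {1..m}" using y by simp
          ultimately have "?T (Suc y) j' = 0" using T[OF Sy j(2)] by simp
          then have "?T (Suc y) j = 0" using L Sy j by blast
          then show False using T[OF Sy j(1)] y(2) by simp
        qed
        moreover have "c j < c j'" if "\<tau> (c j) = \<tau> (c j')"
        proof -
          have "\<forall>i\<in>{1..m}. ?T i j = ?T i j'" using T j that by simp
          then show ?thesis using L j by blast
        qed
        ultimately show "lex_less \<tau> (c j) (c j')" by (auto simp: lex_less_def)
      qed
    next
      assume R: ?R
      have ?L1
      proof (intro ballI impI)
        fix i j j' assume *: "i \<in> {1..m}" "j \<in> {1..n}" "j' \<in> {1..n}" "j' < j \<and> ?T i j = 0"
        then have "lex_less \<tau> (c j') (c j)" using R by blast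
        then have "\<tau> (c j') \<le> \<tau> (c j)" by (auto simp: lex_less_def)
        then show "?T i j' = 0" using * T[of i j] T[of i j'] by simp
      qed
      moreover have ?L2
      proof (intro ballI impI)
        fix j j' assume *: "j \<in> {1..n}" "j' \<in> {1..n}" "j < j' \<and> (\<forall>i\<in>{1..m}. ?T i j = ?T i j')"
        then have lex: "lex_less \<tau> (c j) (c j')" using R by blast
        have "\<not> \<tau> (c j) < \<tau> (c j')"
        proof
          assume lt: "\<tau> (c j) < \<tau> (c j')"
          obtain y where y: "y < m" "Suc (\<tau> y) = \<tau> (c j')" using pred_col c *(2) by blast
          then have Sy: "Suc y \<in> {1..m}" by simp
          then have "?T (Suc y) j = ?T (Suc y) j'" using *(3) by blast
          then show False using T[OF Sy *(1)] T[OF Sy *(2)] lt y(2) by simp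
        qed
        then show "c j < c j'" using lex by (auto simp: lex_less_def)
      qed
      ultimately show "?L1 \<and> ?L2" ..
    qed
  qed
  then show ?thesis
    unfolding cols_arranged_def col_labelling_def sorts_def Let_def by blast
qed

lemma rows_arranged_iff:
  assumes bc: "bij_betw c {1..n} {m..<m+n}"
  shows "rows_arranged m n (permute_cols m (ew_tableau m n \<tau>) c) r \<longleftrightarrow> sorts m {0..<m} \<tau> r"
proof -
  let ?T = "permute_rows (permute_cols m (ew_tableau m n \<tau>) c) r"
  have c: "c \<in> {1..n} \<rightarrow> {m..<m+n}" using bc by (auto simp: bij_betw_def)
  have "((\<forall>i\<in>{1..m}. \<forall>i'\<in>{1..m}. \<forall>j\<in>{1..n}. i' < i \<and> ?T i j = 1 \<longrightarrow> ?T i' j = 1) \<and>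
        (\<forall>i\<in>{1..m}. \<forall>i'\<in>{1..m}. i < i' \<and> (\<forall>j\<in>{1..n}. ?T i j = ?T i' j) \<longrightarrow> r i < r i')) \<longleftrightarrow>
        (\<forall>i\<in>{1..m}. \<forall>i'\<in>{1..m}. i < i' \<longrightarrow> lex_less \<tau> (r i) (r i'))" (is "?L1 \<and> ?L2 \<longleftrightarrow> ?R")
    if bij: "bij_betw r {1..m} {0..<m}"
  proof -
    have r: "r \<in> {1..m} \<rightarrow> {0..<m}" using bij by (auto simp: bij_betw_def)
    have T: "?T i j = of_bool (\<tau> (r i) < \<tau> (c j))" if "i \<in> {1..m}" "j \<in> {1..n}" for i j
      using ew_tableau_rows_cols[OF r c that] .
    \<comment> \<open>The separating column is taken one level below row \<open>r i'\<close>; parity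
      forbids it to share the level of row \<open>r i\<close>, so it lies strictly above.\<close>
    have sep: "\<exists>j\<in>{1..n}. \<tau> (r i) < \<tau> (c j) \<and> \<not> \<tau> (r i') < \<tau> (c j)"
      if i: "i \<in> {1..m}" "i' \<in> {1..m}" and lt: "\<tau> (r i) < \<tau> (r i')" for i i'
    proof -
      have ri: "r i < m" "r i' < m" using r i by auto
      have "r i' \<noteq> 0" using lt tau_0 by (metis not_less_zero)
      then obtain y where y: "y \<in> {m..<m+n}" "Suc (\<tau> y) = \<tau> (r i')" using pred_row ri by blast
      then obtain j where j: "j \<in> {1..n}" "c j = y" using bc by (metis bij_betw_def imageE)
      have "\<tau> (r i) \<noteq> \<tau> y" using parity_sides ri y(1) by metis
      then show ?thesis using j y lt by (intro bexI[of _ j]) auto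
    qed
    show ?thesis
    proof
      assume L: "?L1 \<and> ?L2"
      show ?R
      proof (intro ballI impI)
        fix i i' assume i: "i \<in> {1..m}" "i' \<in> {1..m}" "i < i'"
        have "\<tau> (r i) \<le> \<tau> (r i')"
        proof (rule ccontr)
          assume "\<not> \<tau> (r i) \<le> \<tau> (r i')"
          then obtain j where j: "j \<in> {1..n}" "\<tau> (r i') < \<tau> (c j)" "\<not> \<tau> (r i) < \<tau> (c j)"
            using sep[OF i(2,1)] by auto
          then have "?T i' j = 1" "?T i j = 0" using T i by simp_all
          moreover have "?T i' j = 1 \<longrightarrow> ?T i j = 1" using L i j(1) by blast
          ultimately show False by simp
        qed
        moreover have "r i < r i'" if "\<tau> (r i) = \<tau> (r i')"
        proof -
          have "\<forall>j\<in>{1..n}. ?T i j = ?T i' j" using T i that by simp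
          then show ?thesis using L i by blast
        qed
        ultimately show "lex_less \<tau> (r i) (r i')" by (auto simp: lex_less_def)
      qed
    next
      assume R: ?R
      have ?L1
      proof (intro ballI impI)
        fix i i' j assume *: "i \<in> {1..m}" "i' \<in> {1..m}" "j \<in> {1..n}" "i' < i \<and> ?T i j = 1"
        then have "lex_less \<tau> (r i') (r i)" using R by blast
        then have "\<tau> (r i') \<le> \<tau> (r i)" by (auto simp: lex_less_def)
        moreover have "\<tau> (r i) < \<tau> (c j)" using *(4) T[OF *(1,3)] by (metis of_bool_eq_1_iff)
        ultimately show "?T i' j = 1" using T[OF *(2,3)] by simp
      qed
      moreover have ?L2
      proof (intro ballI impI)
        fix i i' assume *: "i \<in> {1..m}" "i' \<in> {1..m}" "i < i' \<and> (\<forall>j\<in>{1..n}. ?T i j = ?T i' j)"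
        then have lex: "lex_less \<tau> (r i) (r i')" using R by blast
        have "\<not> \<tau> (r i) < \<tau> (r i')"
        proof
          assume "\<tau> (r i) < \<tau> (r i')"
          then obtain j where j: "j \<in> {1..n}" "\<tau> (r i) < \<tau> (c j)" "\<not> \<tau> (r i') < \<tau> (c j)"
            using sep[OF *(1,2)] by auto
          moreover have "?T i j = ?T i' j" using *(3) j(1) by blast
          ultimately show False using T[OF *(1) j(1)] T[OF *(2) j(1)] by simp
        qed
        then show "r i < r i'" using lex by (auto simp: lex_less_def)
      qed
      ultimately show "?L1 \<and> ?L2" ..
    qed
  qed
  then show ?thesis
    unfolding rows_arranged_def row_labelling_def sorts_def Let_def by blast
qed

lemma row_position:
  assumes "bij_betw r {1..m} {0..<m}" "mono_on {1..m} (\<lambda>i. \<tau> (r i))" "i \<in> {1..m}" "even t"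
  shows "\<tau> (r i) \<le> t \<longleftrightarrow> i \<le> cnt t"
  using position_le[OF assms(1-3)] cnt_even[OF assms(4)] by simp

lemma col_position:
  assumes "bij_betw c {1..n} {m..<m+n}" "mono_on {1..n} (\<lambda>j. \<tau> (c j))" "j \<in> {1..n}" "odd t"
  shows "\<tau> (c j) \<le> t \<longleftrightarrow> j \<le> cnt t"
  using position_le[OF assms(1-3)] cnt_odd[OF assms(4)] by simp

text \<open>After sorting, the 1s of column \<open>j\<close> fill the rows up to
  \<open>F0 (c j)\<close>, and the 0s of row \<open>i\<close> fill the columns up to
  \<open>F0 (r i)\<close>. The border consists of the last 1 of each column and the last 0 of each
  row.\<close>

lemma border_eq:
  assumes sr: "sorts m {0..<m} \<tau> r" and sc: "sorts n {m..<m+n} \<tau> c"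
  shows "border m n (permute_rows (permute_cols m (ew_tableau m n \<tau>) c) r)
    = polyomino m n (\<lambda>i. F0 (r i)) (\<lambda>j. F0 (c j))"
proof (intro ext)
  fix i j
  let ?T = "permute_rows (permute_cols m (ew_tableau m n \<tau>) c) r"
  have br: "bij_betw r {1..m} {0..<m}" and bc: "bij_betw c {1..n} {m..<m+n}"
    using sr sc by (simp_all add: sorts_def)
  note mr = sorts_mono[OF sr] and mc = sorts_mono[OF sc]
  have r: "r \<in> {1..m} \<rightarrow> {0..<m}" and c: "c \<in> {1..n} \<rightarrow> {m..<m+n}"
    using br bc by (auto simp: bij_betw_def)
  have T: "?T i j = of_bool (\<tau> (r i) < \<tau> (c j))" if "i \<in> {1..m}" "j \<in> {1..n}" for i j
    using ew_tableau_rows_cols[OF r c that] .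
  have par: "even (\<tau> (r i))" "odd (\<tau> (c j))" if "i \<in> {1..m}" "j \<in> {1..n}" for i j
    using parity_sides that r c by (auto simp: Pi_iff)
  have T01: "?T i j = 1 \<longleftrightarrow> ?T i j \<noteq> 0" if "i \<in> {1..m}" "j \<in> {1..n}" for i j
    unfolding T[OF that] by simp
  have T1: "?T i j = 1 \<longleftrightarrow> i \<le> F0 (c j)" if "i \<in> {1..m}" "j \<in> {1..n}" for i j
  proof -
    have "even (\<tau> (c j) - 1)" "\<tau> (c j) \<noteq> 0" using par(2)[OF that] by (auto simp: odd_pos)
    then have "\<tau> (r i) < \<tau> (c j) \<longleftrightarrow> i \<le> cnt (\<tau> (c j) - 1)"
      using row_position[OF br mr that(1), of "\<tau> (c j) - 1"] by auto
    then show ?thesis using T[OF that] by (simp add: F_def)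
  qed
  \<comment> \<open>A row of level 0 has no 0, although truncation gives it
    \<open>F0 (r i) = 1\<close>.\<close>
  have T0: "?T i j = 0 \<longleftrightarrow> \<tau> (r i) \<noteq> 0 \<and> j \<le> F0 (r i)" if "i \<in> {1..m}" "j \<in> {1..n}" for i j
  proof (cases "\<tau> (r i) = 0")
    case True
    then show ?thesis using T[OF that] par(2)[OF that] by (simp add: odd_pos)
  next
    case False
    then have "odd (\<tau> (r i) - 1)" using par(1)[OF that] by auto
    then have "\<tau> (c j) \<le> \<tau> (r i) - 1 \<longleftrightarrow> j \<le> cnt (\<tau> (r i) - 1)"
      using col_position[OF bc mc that(2)] by simp
    moreover have "\<tau> (r i) \<noteq> \<tau> (c j)" using par[OF that] by metis
    ultimately have "\<not> \<tau> (r i) < \<tau> (c j) \<longleftrightarrow> j \<le> cnt (\<tau> (r i) - 1)"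
      using False by linarith
    then show ?thesis using T[OF that] False by (simp add: F_def)
  qed
  show "border m n ?T i j = polyomino m n (\<lambda>i. F0 (r i)) (\<lambda>j. F0 (c j)) i j"
  proof (cases "i \<in> {1..m} \<and> j \<in> {1..n}")
    case False
    then show ?thesis by (auto simp: border_def polyomino_def)
  next
    case True
    then have ij: "i \<in> {1..m}" "j \<in> {1..n}" by auto
    have le: "F0 (r i) \<le> n" "F0 (c j) \<le> m"
      using F_even_le[OF admissible_0, of "r i"] F_odd_le[OF admissible_0, of "c j"] r c ij
      by (auto simp: Pi_iff)
    have down: "(i = m \<or> ?T (i + 1) j = 0) \<longleftrightarrow> F0 (c j) \<le> i"
    proof (cases "i = m")
      case False
      then have "i + 1 \<in> {1..m}" using ij by auto
      then have "?T (i + 1) j = 0 \<longleftrightarrow> \<not> i + 1 \<le> F0 (c j)"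
        using T1 T01 ij(2) by metis
      then show ?thesis using False by auto
    qed (use le in simp)
    have right: "(j = n \<or> ?T i (j + 1) = 1) \<longleftrightarrow> F0 (r i) \<le> j" if "\<tau> (r i) \<noteq> 0"
    proof (cases "j = n")
      case False
      then have "j + 1 \<in> {1..n}" using ij by auto
      then have "?T i (j + 1) = 1 \<longleftrightarrow> \<not> j + 1 \<le> F0 (r i)"
        using T0 T01 ij(1) that by metis
      then show ?thesis using False by auto
    qed (use le in simp)
    have F1: "F0 (r i) = 1" if "\<tau> (r i) = 0" using that by (simp add: F_def cnt_0)
    have "(?T i j = 1 \<and> (i = m \<or> ?T (i + 1) j = 0) \<or> ?T i j = 0 \<and> (j = n \<or> ?T i (j + 1) = 1))
        \<longleftrightarrow> F0 (r i) \<le> j \<and> F0 (c j) \<le> i"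
      using T1[OF ij] T0[OF ij] T01[OF ij] down right F1 ij
      by (cases "\<tau> (r i) = 0"; cases "?T i j = 0") auto
    then show ?thesis using True unfolding border_def polyomino_def by simp
  qed
qed

lemma sorter_F0:
  "sorter m {0..<m} F0 = sorter m {0..<m} \<tau>" "sorter n {m..<m+n} F0 = sorter n {m..<m+n} \<tau>"
  by (rule sorter_eq, rule sorts_F0, rule sorts_sorter; simp)+

text \<open>By uniqueness of sorting, the definite descriptions in \<open>phi\<close> denote the
  sorters by level, which sort by \<open>F0\<close> as well.\<close>

lemma phi_ew_tableau: "phi m n (ew_tableau m n \<tau>) = assemble m n F0"
proof -
  let ?c = "sorter n {m..<m+n} \<tau>" and ?r = "sorter m {0..<m} \<tau>"
  have sc: "sorts n {m..<m+n} \<tau> ?c" and sr: "sorts m {0..<m} \<tau> ?r"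
    by (rule sorts_sorter; simp)+
  have bc: "bij_betw ?c {1..n} {m..<m+n}" using sc by (simp add: sorts_def)
  have "(THE c. cols_arranged m n (ew_tableau m n \<tau>) c) = ?c"
    by (simp add: cols_arranged_iff sorter_def)
  moreover have "(THE r. rows_arranged m n (permute_cols m (ew_tableau m n \<tau>) ?c) r) = ?r"
    using rows_arranged_iff[OF bc] by (simp add: sorter_def)
  ultimately show ?thesis
    using border_eq[OF sr sc] by (simp add: phi_def assemble_def sorter_F0 Let_def)
qed

lemma F0_mono:
  assumes "x < m + n" "y < m + n" "even (\<tau> x) = even (\<tau> y)" "\<tau> x \<le> \<tau> y"
  shows "F0 x \<le> F0 y"
proof (cases "\<tau> x = 0")
  case True
  then show ?thesis using cnt_pos by (simp add: F_def cnt_0)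
next
  case False
  then have "\<tau> x - 1 \<le> \<tau> y - 1" "even (\<tau> x - 1) = even (\<tau> y - 1)" using assms by auto
  then have "cnt (\<tau> x - 1) \<le> cnt (\<tau> y - 1)" by (rule cnt_mono)
  then show ?thesis by (simp add: F_def)
qed

end

section \<open>Bouncing the polyomino of a layering\<close>

text \<open>The arrangement is sorted by \<open>F s\<close>, but \<open>\<tau>\<close> and
  \<open>F0\<close> are monotone along it too. So the bounce ribbon can be described with the same
  \<open>r\<close> and \<open>c\<close> before any relabelling.\<close>

locale sorted_layering = layering +
  fixes s r c :: "nat \<Rightarrow> nat"
  assumes adm: "admissible s"
    and sorts_r: "sorts m {0..<m} (F s) r" and sorts_c: "sorts n {m..<m+n} (F s) c"
begin

lemma bij_r: "bij_betw r {1..m} {0..<m}" and bij_c: "bij_betw c {1..n} {m..<m+n}"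
  using sorts_r sorts_c by (simp_all add: sorts_def)

lemma r_in: "i \<in> {1..m} \<Longrightarrow> r i < m" and c_in: "j \<in> {1..n} \<Longrightarrow> c j \<in> {m..<m+n}"
  using bij_betw_apply[OF bij_r] bij_betw_apply[OF bij_c] by auto

lemma c_less: "j \<in> {1..n} \<Longrightarrow> c j < m + n"
  using c_in by simp

lemma even_r: "i \<in> {1..m} \<Longrightarrow> even (\<tau> (r i))" and odd_c: "j \<in> {1..n} \<Longrightarrow> odd (\<tau> (c j))"
  using parity_sides r_in c_in by blast+

lemma mono_tau_r: "mono_on {1..m} (\<lambda>i. \<tau> (r i))"
proof (rule mono_onI)
  fix i i' assume i: "i \<in> {1..m}" "i' \<in> {1..m}" "i \<le> i'"
  show "\<tau> (r i) \<le> \<tau> (r i')"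
  proof (cases "i = i'")
    case False
    then have "lex_less (F s) (r i) (r i')" using i sorts_r unfolding sorts_def by (metis le_neq_implies_less)
    then show ?thesis
      using tau_le_of_lex[OF adm] r_in[OF i(1)] r_in[OF i(2)] even_r[OF i(1)] even_r[OF i(2)] by auto
  qed simp
qed

lemma mono_tau_c: "mono_on {1..n} (\<lambda>j. \<tau> (c j))"
proof (rule mono_onI)
  fix j j' assume j: "j \<in> {1..n}" "j' \<in> {1..n}" "j \<le> j'"
  show "\<tau> (c j) \<le> \<tau> (c j')"
  proof (cases "j = j'")
    case False
    then have "lex_less (F s) (c j) (c j')" using j sorts_c unfolding sorts_def by (metis le_neq_implies_less)
    then show ?thesis
      using tau_le_of_lex[OF adm] c_less[OF j(1)] c_less[OF j(2)] odd_c[OF j(1)] odd_c[OF j(2)] by auto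
  qed simp
qed

lemma mono_F0_r: "mono_on {1..m} (\<lambda>i. F0 (r i))"
proof (rule mono_onI)
  fix i i' assume i: "i \<in> {1..m}" "i' \<in> {1..m}" "i \<le> i'"
  then show "F0 (r i) \<le> F0 (r i')"
    using F0_mono[of "r i" "r i'"] mono_onD[OF mono_tau_r i] r_in[OF i(1)] r_in[OF i(2)] even_r by simp
qed

lemma mono_F0_c: "mono_on {1..n} (\<lambda>j. F0 (c j))"
proof (rule mono_onI)
  fix i i' assume i: "i \<in> {1..n}" "i' \<in> {1..n}" "i \<le> i'"
  then show "F0 (c i) \<le> F0 (c i')"
    using F0_mono[of "c i" "c i'"] mono_onD[OF mono_tau_c i] c_less[OF i(1)] c_less[OF i(2)] odd_c by simp
qed

lemma r_1: "r 1 = 0"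
proof -
  have "0 \<in> r ` {1..m}" using bij_r m_pos by (simp add: bij_betw_imp_surj_on)
  then obtain i where i: "i \<in> {1..m}" "r i = 0" by (metis imageE)
  then have "\<tau> (r 1) \<le> \<tau> 0" using mono_onD[OF mono_tau_r, of 1 i] by simp
  then have "\<tau> (r 1) = 0" using tau_0 by simp
  moreover have "r 1 < m + n" using r_in[of 1] m_pos by simp
  ultimately show ?thesis using zero_iff by blast
qed

lemma row_pos: "i \<in> {1..m} \<Longrightarrow> even t \<Longrightarrow> \<tau> (r i) \<le> t \<longleftrightarrow> i \<le> cnt t"
  by (rule row_position[OF bij_r mono_tau_r])

lemma col_pos: "j \<in> {1..n} \<Longrightarrow> odd t \<Longrightarrow> \<tau> (c j) \<le> t \<longleftrightarrow> j \<le> cnt t"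
  by (rule col_position[OF bij_c mono_tau_c])

text \<open>The surplus \<open>s'\<close> need not be the one used for sorting, so that the lemma
  covers both \<open>F s\<close> and \<open>F0\<close>. For the overlap: a row of level
  \<open>t + 2\<close> starts in a column of level at most \<open>t + 1\<close>, whose top is at
  most \<open>cnt t\<close>, and the row itself lies below row \<open>cnt t\<close>. The argument
  for columns is dual.\<close>

lemma boundary_F:
  assumes adm': "admissible s'"
    and mF: "mono_on {1..m} (\<lambda>i. F s' (r i))" "mono_on {1..n} (\<lambda>j. F s' (c j))"
  shows "boundary m n (\<lambda>i. F s' (r i)) (\<lambda>j. F s' (c j))"
proof -
  have aR: "F s' (r i) \<in> {1..n}" if "i \<in> {1..m}" for i using F_even_le[OF adm' r_in[OF that]] .
  have bR: "F s' (c j) \<in> {1..m}" if "j \<in> {1..n}" for j using F_odd_le[OF adm' c_in[OF that]] .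
  have a1: "F s' (r 1) = 1" using r_1 F_0[OF adm'] by simp
  have b1: "F s' (c 1) = 1"
  proof -
    have "1 \<le> cnt 1" by (rule cnt_1)
    then have "\<tau> (c 1) \<le> 1" using col_pos[of 1 1] n_pos by simp
    then have "F s' (c 1) \<le> cnt 0"
      using F_le_cnt_iff[OF adm', of "c 1" 0] c_less[of 1] odd_c[of 1] n_pos by simp
    then show ?thesis using bR[of 1] n_pos cnt_0 by simp
  qed
  have ba: "F s' (c (F s' (r (Suc i)))) \<le> i" if i: "i \<in> {1..<m}" for i
  proof -
    let ?x = "r (Suc i)"
    have Si: "Suc i \<in> {1..m}" "1 \<in> {1..m}" using i by auto
    have "?x \<noteq> r 1" using inj_onD[OF bij_betw_imp_inj_on[OF bij_r] _ Si] i by auto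
    then have "\<tau> ?x \<noteq> 0" using zero_iff[of ?x] r_in[OF Si(1)] r_1 by simp
    then obtain t where t: "\<tau> ?x = Suc (Suc t)" "even t"
      using even_r[OF Si(1)] by (cases "\<tau> ?x"; cases "\<tau> ?x - 1") auto
    let ?a = "F s' ?x"
    have "?a \<le> cnt (Suc t)"
      using F_le_cnt_iff[OF adm', of ?x "Suc t"] t r_in[OF Si(1)] by simp
    then have "\<tau> (c ?a) \<le> Suc t" using col_pos[OF aR[OF Si(1)]] t(2) by simp
    then have "F s' (c ?a) \<le> cnt t"
      using F_le_cnt_iff[OF adm' c_less[OF aR[OF Si(1)]]] odd_c[OF aR[OF Si(1)]] t(2) by simp
    moreover have "\<not> Suc i \<le> cnt t" using row_pos[OF Si(1) t(2)] t(1) by simp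
    ultimately show ?thesis by simp
  qed
  have ab: "F s' (r (F s' (c (Suc j)))) \<le> j" if j: "j \<in> {1..<n}" for j
  proof -
    let ?w = "c (Suc j)"
    have Sj: "Suc j \<in> {1..n}" using j by auto
    obtain t where t: "\<tau> ?w = Suc t" "even t" using odd_c[OF Sj] by (cases "\<tau> ?w") auto
    let ?b = "F s' ?w"
    have "?b \<le> cnt t"
      using F_le_cnt_iff[OF adm' c_less[OF Sj], of t] t by simp
    then have le: "\<tau> (r ?b) \<le> t" using row_pos[OF bR[OF Sj] t(2)] by simp
    show ?thesis
    proof (cases "t = 0")
      \<comment> \<open>For level 1 there is no odd level below \<open>t\<close>; the column then
        starts in row 1, whose left end is 1.\<close>
      case True
      then have "?b = 1" using \<open>?b \<le> cnt t\<close> bR[OF Sj] cnt_0 by simp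
      then show ?thesis using a1 j by simp
    next
      case False
      then obtain u where u: "t = Suc u" "odd u" using t(2) by (cases t) auto
      have "r ?b < m + n" using r_in[OF bR[OF Sj]] by simp
      then have "F s' (r ?b) \<le> cnt u"
        using F_le_cnt_iff[OF adm', of "r ?b" u] even_r[OF bR[OF Sj]] u le by simp
      moreover have "\<not> Suc j \<le> cnt u" using col_pos[OF Sj u(2)] t(1) u(1) by simp
      ultimately show ?thesis by simp
    qed
  qed
  show ?thesis
    unfolding boundary_def
    using m_pos n_pos aR bR mF a1 b1 ba ab by blast
qed

section \<open>The polyomino with surplus and its bounce path\<close>

definition "P = polyomino m n (\<lambda>i. F s (r i)) (\<lambda>j. F s (c j))"

lemma boundary_P: "boundary m n (\<lambda>i. F s (r i)) (\<lambda>j. F s (c j))"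
  by (rule boundary_F[OF adm sorts_mono[OF sorts_r] sorts_mono[OF sorts_c]])

lemma boundary_P0: "boundary m n (\<lambda>i. F0 (r i)) (\<lambda>j. F0 (c j))"
  by (rule boundary_F[OF admissible_0 mono_F0_r mono_F0_c])

text \<open>By \<open>F_le_cnt_iff\<close> the columns starting at or above row \<open>cnt t\<close>
  are those of level at most \<open>t + 1\<close>, whatever the surplus; they occupy the first
  \<open>cnt (Suc t)\<close> positions.\<close>

lemma rightmost_P:
  assumes "even t"
  shows "rightmost n P (cnt t) = cnt (Suc t)"
proof -
  have t: "cnt t \<in> {1..m}" using cnt_pos[of t] cnt_even_le[OF assms] by simp
  have le: "cnt (Suc t) \<le> n" using cnt_odd_le[of "Suc t"] assms by simp
  have "F s (c j) \<le> cnt t \<longleftrightarrow> j \<le> cnt (Suc t)" if "j \<in> {1..n}" for j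
    using F_le_cnt_iff[OF adm c_less[OF that], of t] odd_c[OF that] col_pos[OF that, of "Suc t"] assms
    by simp
  then have "{j \<in> {1..n}. F s (c j) \<le> cnt t} = {1..cnt (Suc t)}" using le by auto
  then show ?thesis using rightmost_polyomino[OF boundary_P t] by (simp add: P_def)
qed

lemma lowest_P:
  assumes "odd t"
  shows "lowest m P (cnt t) = cnt (Suc t)"
proof -
  have t: "cnt t \<in> {1..n}" using cnt_pos[of t] cnt_odd_le[OF assms] by simp
  have le: "cnt (Suc t) \<le> m" using cnt_even_le[of "Suc t"] assms by simp
  have "F s (r i) \<le> cnt t \<longleftrightarrow> i \<le> cnt (Suc t)" if "i \<in> {1..m}" for i
    using F_le_cnt_iff[OF adm, of "r i" t] r_in[OF that] even_r[OF that] row_pos[OF that, of "Suc t"] assms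
    by simp
  then have "{i \<in> {1..m}. F s (r i) \<le> cnt t} = {1..cnt (Suc t)}" using le by auto
  then show ?thesis using lowest_polyomino[OF boundary_P t] by (simp add: P_def)
qed

text \<open>The runs begin only at cells with consecutive values of \<open>cnt\<close> as
  coordinates. At \<open>t = 0\<close> truncation turns \<open>cnt (t - 1)\<close> into
  \<open>cnt 0 = 1\<close>, the starting cell.\<close>

lemma right_down_from:
  "(right_from m n P i j \<longrightarrow> (\<exists>t. even t \<and> i = cnt t \<and> j = cnt (t - 1))) \<and>
   (down_from m n P i' j' \<longrightarrow> (\<exists>t. even t \<and> i' = cnt t \<and> j' = cnt (Suc t)))"
proof (induction rule: right_from_down_from.induct)
  case start
  then show ?case using cnt_0 by (intro exI[of _ 0]) simp
next
  case (turn_down i j)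
  then show ?case using rightmost_P by auto
next
  case (turn_right i j)
  then obtain t where t: "even t" "i = cnt t" "j = cnt (Suc t)" by blast
  then show ?case using lowest_P[of "Suc t"] by (intro exI[of _ "Suc (Suc t)"]) simp
qed

text \<open>Conversely every even level is reached: one right run and one down run lead to it from
  the previous even level.\<close>

lemma right_from_even: "even t \<Longrightarrow> right_from m n P (cnt t) (cnt (t - 1))"
proof (induction t rule: nat_less_induct)
  case (1 t)
  show ?case
  proof (cases "t = 0")
    case True
    then show ?thesis using right_from_down_from.start[of m n P] cnt_0 by simp
  next
    case False
    then obtain u where u: "t = Suc (Suc u)" "even u" using 1(2) by (cases t; cases "t - 1") auto
    then have "right_from m n P (cnt u) (cnt (u - 1))" using 1 by simp
    then have "down_from m n P (cnt u) (cnt (Suc u))"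
      using right_from_down_from.turn_down rightmost_P[OF u(2)] by metis
    then have "right_from m n P (lowest m P (cnt (Suc u))) (cnt (Suc u))"
      by (rule right_from_down_from.turn_right)
    then show ?thesis using lowest_P[of "Suc u"] u by simp
  qed
qed

lemma down_from_even: "even t \<Longrightarrow> down_from m n P (cnt t) (cnt (Suc t))"
  using right_from_down_from.turn_down[OF right_from_even] rightmost_P by simp

text \<open>Compare the level \<open>p\<close> of the row with the level \<open>u + 1\<close> of the
  column. A cell of the ribbon has \<open>p = u\<close> or \<open>p = u + 2\<close>; the first case
  is a right run in row \<open>cnt u\<close>, the second a down run in column
  \<open>cnt (Suc u)\<close>.\<close>

lemma bounce_P: "bounce m n P = polyomino m n (\<lambda>i. F0 (r i)) (\<lambda>j. F0 (c j))"
proof (intro ext)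
  fix i j
  let ?right = "\<exists>t. even t \<and> i = cnt t \<and> cnt (t - 1) \<le> j \<and> j \<le> cnt (Suc t)"
  let ?down = "\<exists>t. even t \<and> j = cnt (Suc t) \<and> cnt t \<le> i \<and> i \<le> cnt (Suc (Suc t))"
  have R: "(\<exists>j\<^sub>0. right_from m n P i j\<^sub>0 \<and> j\<^sub>0 \<le> j \<and> j \<le> rightmost n P i) \<longleftrightarrow> ?right"
    using right_down_from right_from_even rightmost_P by metis
  have D: "(\<exists>i\<^sub>0. down_from m n P i\<^sub>0 j \<and> i\<^sub>0 \<le> i \<and> i \<le> lowest m P j) \<longleftrightarrow> ?down"
    using right_down_from down_from_even lowest_P by (metis even_Suc)
  have "?right \<or> ?down \<longleftrightarrow> i \<in> {1..m} \<and> j \<in> {1..n} \<and> F0 (r i) \<le> j \<and> F0 (c j) \<le> i"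
  proof
    assume RD: "?right \<or> ?down"
    then obtain t where t: "even t" "cnt t \<le> i" "cnt (t - 1) \<le> j" "j \<le> cnt (Suc t)"
      and i: "i = cnt t \<or> i \<le> cnt (Suc (Suc t)) \<and> j = cnt (Suc t)"
    proof (elim disjE exE conjE)
      fix t assume "even t" "j = cnt (Suc t)" "cnt t \<le> i" "i \<le> cnt (Suc (Suc t))"
      \<comment> \<open>At \<open>t = 0\<close> truncation compares counts of different parity,
        which \<open>cnt_mono\<close> does not cover.\<close>
      moreover have "cnt (t - 1) \<le> cnt (Suc t)"
      proof (cases "t = 0")
        case False
        then show ?thesis by (intro cnt_mono) auto
      qed (use cnt_0 cnt_1 in simp)
      ultimately show thesis using that by blast
    qed (use that in blast)
    have "cnt t \<le> m" "cnt (Suc t) \<le> n" "cnt (Suc (Suc t)) \<le> m"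
      using t(1) by (auto intro: cnt_even_le cnt_odd_le)
    moreover have "1 \<le> cnt t" "1 \<le> cnt (t - 1)" by (rule cnt_pos)+
    ultimately have ij: "i \<in> {1..m}" "j \<in> {1..n}" using t i by auto
    have "\<tau> (c j) \<le> Suc t" using col_pos[OF ij(2)] t by simp
    then have "F0 (c j) \<le> cnt t"
      using F_le_cnt_iff[OF admissible_0 c_less[OF ij(2)], of t] odd_c[OF ij(2)] t by simp
    moreover have "F0 (r i) \<le> j"
    proof (cases "i = cnt t")
      case True
      then have *: "\<tau> (r i) \<le> t" using row_pos[OF ij(1)] t by simp
      show ?thesis
      proof (cases "t = 0")
        case True
        then show ?thesis using * ij by (simp add: F_def cnt_0)
      next
        case False
        then have "F0 (r i) \<le> cnt (t - 1)"
          using F_le_cnt_iff[OF admissible_0, of "r i" "t - 1"] r_in[OF ij(1)] even_r[OF ij(1)] t(1) *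
          by simp
        then show ?thesis using t by simp
      qed
    next
      case False
      then have "i \<le> cnt (Suc (Suc t))" "j = cnt (Suc t)" using i by auto
      then show ?thesis
        using F_le_cnt_iff[OF admissible_0, of "r i" "Suc t"] r_in[OF ij(1)] even_r[OF ij(1)] t(1)
          row_pos[OF ij(1), of "Suc (Suc t)"] by simp
    qed
    ultimately show "i \<in> {1..m} \<and> j \<in> {1..n} \<and> F0 (r i) \<le> j \<and> F0 (c j) \<le> i"
      using ij t by simp
  next
    assume *: "i \<in> {1..m} \<and> j \<in> {1..n} \<and> F0 (r i) \<le> j \<and> F0 (c j) \<le> i"
    then have ij: "i \<in> {1..m}" "j \<in> {1..n}" and F: "cnt (\<tau> (r i) - 1) \<le> j" "cnt (\<tau> (c j) - 1) \<le> i"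
      by (auto simp: F_def)
    define p where "p = \<tau> (r i)"
    obtain u where u: "\<tau> (c j) = Suc u" "even u" using odd_c[OF ij(2)] by (cases "\<tau> (c j)") auto
    have p: "even p" using even_r[OF ij(1)] by (simp add: p_def)
    have ip: "i \<le> cnt p" using row_pos[OF ij(1) p] by (simp add: p_def)
    have ju: "j \<le> cnt (Suc u)" using col_pos[OF ij(2), of "Suc u"] u by simp
    have Fp: "cnt (p - 1) \<le> j" and Fu: "cnt u \<le> i" using F u by (simp_all add: p_def)
    \<comment> \<open>\<open>cnt\<close> increases strictly only at inhabited levels;
      \<open>tau_occurs\<close> guarantees that level \<open>u\<close> is one.\<close>
    have "u \<le> p"
    proof (rule ccontr)
      assume "\<not> u \<le> p"
      moreover obtain y where "y < m + n" "\<tau> y = u" using tau_occurs[OF c_less[OF ij(2)], of u] u by auto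
      ultimately have "cnt p < cnt u" using cnt_strict[of y p] p u by auto
      then show False using Fu ip by simp
    qed
    have "p \<le> Suc (Suc u)"
    proof (rule ccontr)
      assume **: "\<not> p \<le> Suc (Suc u)"
      moreover obtain y where "y < m + n" "\<tau> y = p - 1"
        using tau_occurs[of "r i" "p - 1"] r_in[OF ij(1)] by (auto simp: p_def)
      ultimately have "cnt (Suc u) < cnt (p - 1)" using cnt_strict[of y "Suc u"] p u by auto
      then show False using Fp ju by simp
    qed
    then have "p = u \<or> p = Suc (Suc u)" using \<open>u \<le> p\<close> p u(2) by (cases "p = Suc u") auto
    then show "?right \<or> ?down"
    proof
      assume "p = u"
      then have "even p \<and> i = cnt p \<and> cnt (p - 1) \<le> j \<and> j \<le> cnt (Suc p)"
        using p ip Fu Fp ju by simp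
      then show ?thesis by blast
    next
      assume "p = Suc (Suc u)"
      then have "even u \<and> j = cnt (Suc u) \<and> cnt u \<le> i \<and> i \<le> cnt (Suc (Suc u))"
        using u ip Fu Fp ju by simp
      then show ?thesis by blast
    qed
  qed
  then show "bounce m n P i j = polyomino m n (\<lambda>i. F0 (r i)) (\<lambda>j. F0 (c j)) i j"
    unfolding bounce_def polyomino_def R D by simp
qed

lemma assemble_F: "assemble m n (F s) = (P, r, c)"
  using sorter_eq[OF sorts_r] sorter_eq[OF sorts_c] by (simp add: assemble_def P_def)

text \<open>Sorting the blocks of the ribbon sorts the labels by \<open>F0\<close>. The ribbon
  itself is unaffected, since two listings monotone in \<open>F0\<close> have equal values at each
  position.\<close>

lemma bounce_labelled_assemble: "bounce_labelled m n (P, r, c) = assemble m n F0"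
proof -
  let ?r = "sort_blocks m (leftmost n (bounce m n P)) r"
  let ?c = "sort_blocks n (topmost m (bounce m n P)) c"
  have r': "sorts m {0..<m} F0 ?r"
    by (rule sorts_sort_blocks[OF bij_r mono_F0_r]) (simp add: bounce_P leftmost_polyomino[OF boundary_P0])
  have c': "sorts n {m..<m+n} F0 ?c"
    by (rule sorts_sort_blocks[OF bij_c mono_F0_c]) (simp add: bounce_P topmost_polyomino[OF boundary_P0])
  have b': "bij_betw ?r {1..m} {0..<m}" "bij_betw ?c {1..n} {m..<m+n}"
    using r' c' by (simp_all add: sorts_def)
  have "bounce m n P = polyomino m n (\<lambda>i. F0 (?r i)) (\<lambda>j. F0 (?c j))"
    unfolding bounce_P
    using mono_rearrangement_unique[OF bij_r mono_F0_r b'(1) sorts_mono[OF r']]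
      mono_rearrangement_unique[OF bij_c mono_F0_c b'(2) sorts_mono[OF c']]
    by (intro polyomino_cong) (simp_all add: bounce_P)
  then show ?thesis
    using sorter_eq[OF r'] sorter_eq[OF c'] by (simp add: assemble_def bounce_labelled_def Let_def)
qed

lemma leftmost_at_label_P: "v < m \<Longrightarrow> leftmost_at_label m n (P, r, c) v = F s v"
proof -
  assume "v < m"
  then have "v \<in> r ` {1..m}" using bij_r by (auto simp: bij_betw_def)
  then have "r (inv_into {1..m} r v) = v" "inv_into {1..m} r v \<in> {1..m}"
    by (simp_all only: f_inv_into_f inv_into_into)
  then show ?thesis using leftmost_polyomino[OF boundary_P] by (simp add: leftmost_at_label_def P_def)
qed

lemma topmost_at_label_P: "w \<in> {m..<m+n} \<Longrightarrow> topmost_at_label m n (P, r, c) w = F s w"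
proof -
  assume "w \<in> {m..<m+n}"
  then have "w \<in> c ` {1..n}" using bij_c by (auto simp: bij_betw_def)
  then have "c (inv_into {1..n} c w) = w" "inv_into {1..n} c w \<in> {1..n}"
    by (simp_all only: f_inv_into_f inv_into_into)
  then show ?thesis using topmost_polyomino[OF boundary_P] by (simp add: topmost_at_label_def P_def)
qed

lemma LPara_P: "(P, r, c) \<in> LPara m n"
proof -
  have l: "leftmost n P i = F s (r i)" if "i \<in> {1..m}" for i
    using leftmost_polyomino[OF boundary_P that] by (simp add: P_def)
  have t: "topmost m P j = F s (c j)" if "j \<in> {1..n}" for j
    using topmost_polyomino[OF boundary_P that] by (simp add: P_def)
  have lr: "r i < r i'" if "i \<in> {1..m}" "i' \<in> {1..m}" "i < i'" "F s (r i) = F s (r i')" for i i'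
    using sorts_r that unfolding sorts_def lex_less_def by fastforce
  have lc: "c i < c i'" if "i \<in> {1..n}" "i' \<in> {1..n}" "i < i'" "F s (c i) = F s (c i')" for i i'
    using sorts_c that unfolding sorts_def lex_less_def by fastforce
  have "P \<in> Para m n" unfolding P_def by (rule polyomino_in_Para[OF boundary_P])
  moreover have "row_labelling m r" "col_labelling m n c"
    using sorts_r sorts_c by (simp_all add: row_labelling_def col_labelling_def sorts_def)
  ultimately show ?thesis
    unfolding LPara_def using r_1 l t lr lc by simp
qed

end

context layering
begin

lemma sorted_layering_sorter:
  "admissible s \<Longrightarrow> sorted_layering m n \<tau> s (sorter m {0..<m} (F s)) (sorter n {m..<m+n} (F s))"
  by unfold_locales (simp_all add: sorts_sorter)

lemma assemble_in_LPara: "admissible s \<Longrightarrow> assemble m n (F s) \<in> LPara m n"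
  using sorted_layering.LPara_P[OF sorted_layering_sorter]
    sorted_layering.assemble_F[OF sorted_layering_sorter] by simp

lemma bounce_labelled_F: "admissible s \<Longrightarrow> bounce_labelled m n (assemble m n (F s)) = assemble m n F0"
  using sorted_layering.bounce_labelled_assemble[OF sorted_layering_sorter]
    sorted_layering.assemble_F[OF sorted_layering_sorter] by simp

text \<open>Together with its column counterpart this reads \<open>F s\<close> back from the
  assembled object, so that equal labelled polyominoes have equal position functions.\<close>

lemma leftmost_at_label_F:
  "admissible s \<Longrightarrow> v < m \<Longrightarrow> leftmost_at_label m n (assemble m n (F s)) v = F s v"
  using sorted_layering.leftmost_at_label_P[OF sorted_layering_sorter]
    sorted_layering.assemble_F[OF sorted_layering_sorter] by simp

lemma topmost_at_label_F:
  "admissible s \<Longrightarrow> w \<in> {m..<m+n} \<Longrightarrow> topmost_at_label m n (assemble m n (F s)) w = F s w"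
  using sorted_layering.topmost_at_label_P[OF sorted_layering_sorter]
    sorted_layering.assemble_F[OF sorted_layering_sorter] by simp

text \<open>The subtraction in \<open>F\<close> is not truncated, by \<open>surplus_bound\<close>,
  so the bounce moves each label by exactly its surplus.\<close>

lemma surp_F:
  assumes "admissible s"
  shows "surp m n (assemble m n (F s)) = (\<lambda>x\<in>{1..m+n-1}. int (s x))"
proof -
  have *: "int (F0 x) - int (F s x) = int (s x)" if "x \<in> {1..m+n-1}" for x
  proof -
    have "x < m + n" "x \<noteq> 0" using that m_pos by auto
    then show ?thesis using surplus_bound(1)[OF assms, of x] by (simp add: F_def)
  qed
  show ?thesis
    unfolding surp_def bounce_labelled_F[OF assms]
  proof (intro restrict_ext)
    fix x assume x: "x \<in> {1..m+n-1}"
    have "x \<in> {m..<m+n}" if "\<not> x < m" using x that m_pos by auto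
    then show "(if x < m then int (leftmost_at_label m n (assemble m n F0) x) -
          int (leftmost_at_label m n (assemble m n (F s)) x)
        else int (topmost_at_label m n (assemble m n F0) x) -
          int (topmost_at_label m n (assemble m n (F s)) x)) = int (s x)"
      using *[OF x] leftmost_at_label_F[OF assms] topmost_at_label_F[OF assms]
        leftmost_at_label_F[OF admissible_0] topmost_at_label_F[OF admissible_0] by simp
  qed
qed

end

text \<open>Burning: \<open>F x \<le> cnt t\<close> iff \<open>\<tau> x \<le> t + 1\<close>, so the layers are read off from \<open>F\<close> one after another.\<close>

lemma layering_unique:
  assumes "layering m n \<tau>" "layering m n \<tau>'"
    and adm: "layering.admissible m n \<tau> s" "layering.admissible m n \<tau>' s'"
    and eq: "\<And>x. x < m + n \<Longrightarrow> layering.F m n \<tau> s x = layering.F m n \<tau>' s' x"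
    and x: "x < m + n"
  shows "\<tau> x = \<tau>' x"
proof -
  interpret L: layering m n \<tau> by fact
  interpret L': layering m n \<tau>' by fact
  have "\<forall>x < m + n. \<tau> x \<le> t \<longleftrightarrow> \<tau>' x \<le> t" for t
  proof (induction t)
    case 0
    then show ?case using L.zero_iff L'.zero_iff by simp
  next
    case (Suc t)
    show ?case
    proof (intro allI impI)
      fix x assume x: "x < m + n"
      \<comment> \<open>The count depends only on parities and on which labels have level at most
        \<open>t\<close>; the induction hypothesis settles the latter.\<close>
      have cnt: "L.cnt t = L'.cnt t"
        unfolding L.cnt_def L'.cnt_def
        using Suc L.parity L'.parity by (intro arg_cong[of _ _ card] Collect_cong) blast
      have par: "even (\<tau> x) = even (\<tau>' x)" using L.parity[OF x] L'.parity[OF x] by simp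
      show "\<tau> x \<le> Suc t \<longleftrightarrow> \<tau>' x \<le> Suc t"
      proof (cases "even (\<tau> x) = even t")
        case True
        then have "\<tau> x \<noteq> Suc t" "\<tau>' x \<noteq> Suc t" using par by auto
        then show ?thesis using Suc x by (auto simp: le_Suc_eq)
      next
        case False
        then show ?thesis
          using L.F_le_cnt_iff[OF adm(1) x, of t] L'.F_le_cnt_iff[OF adm(2) x, of t] par cnt eq[OF x]
          by simp
      qed
    qed
  qed
  then show ?thesis using x by (metis order_antisym order_refl)
qed

lemma assemble_cong:
  assumes "\<And>x. x < m + n \<Longrightarrow> F x = G x"
  shows "assemble m n F = assemble m n G"
proof -
  have r: "sorter m {0..<m} F = sorter m {0..<m} G" and c: "sorter n {m..<m+n} F = sorter n {m..<m+n} G"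
    using assms by (intro sorter_cong; simp)+
  have "sorts m {0..<m} G (sorter m {0..<m} G)" "sorts n {m..<m+n} G (sorter n {m..<m+n} G)"
    by (simp_all add: sorts_sorter)
  then have bij: "bij_betw (sorter m {0..<m} G) {1..m} {0..<m}"
      "bij_betw (sorter n {m..<m+n} G) {1..n} {m..<m+n}"
    by (simp_all add: sorts_def)
  have "sorter m {0..<m} G i < m + n" if "i \<in> {1..m}" for i
    using bij_betw_apply[OF bij(1) that] by simp
  moreover have "sorter n {m..<m+n} G j < m + n" if "j \<in> {1..n}" for j
    using bij_betw_apply[OF bij(2) that] by simp
  ultimately have "polyomino m n (\<lambda>i. F (sorter m {0..<m} G i)) (\<lambda>j. F (sorter n {m..<m+n} G j)) =
      polyomino m n (\<lambda>i. G (sorter m {0..<m} G i)) (\<lambda>j. G (sorter n {m..<m+n} G j))"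
    using assms by (intro polyomino_cong) blast+
  then show ?thesis unfolding assemble_def Let_def r c by simp
qed

section \<open>The layering of a labelled polyomino\<close>

text \<open>\<open>G\<close> abstracts the position function of a labelled polyomino. The assumption
  \<open>grow\<close> is the overlap of consecutive rows in terms of labels: from \<open>i\<close>
  burnt rows one reaches columns, and through them more than \<open>i\<close> rows.\<close>

locale burning =
  fixes m n :: nat and G :: "nat \<Rightarrow> nat"
  assumes m_pos: "1 \<le> m" and n_pos: "1 \<le> n"
    and G_0: "G 0 = 1"
    and G_pos: "\<And>x. x < m + n \<Longrightarrow> 1 \<le> G x"
    and G_row: "\<And>v. v < m \<Longrightarrow> G v \<le> n"
    and G_col: "\<And>w. w \<in> {m..<m+n} \<Longrightarrow> G w \<le> m"
    and grow: "\<And>i. i \<in> {1..<m} \<Longrightarrow> i < card {v \<in> {0..<m}. G v \<le> card {w \<in> {m..<m+n}. G w \<le> i}}"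
begin

text \<open>The coordinates of the turning points of the bounce path, alternately rows and columns,
  computed from \<open>G\<close> alone; \<open>q_eq\<close> identifies them with the counts of a
  layering.\<close>

primrec q :: "nat \<Rightarrow> nat" where
  "q 0 = 1"
| "q (Suc t) = card {x. x < m + n \<and> (even (Suc t) \<longleftrightarrow> x < m) \<and> G x \<le> q t}"

declare q.simps(2) [simp del]

lemma q_even: "even t \<Longrightarrow> q (Suc t) = card {w \<in> {m..<m+n}. G w \<le> q t}"
  by (auto simp: q.simps(2) intro!: arg_cong[of _ _ card])

lemma q_odd: "odd t \<Longrightarrow> q (Suc t) = card {v \<in> {0..<m}. G v \<le> q t}"
  by (auto simp: q.simps(2) intro!: arg_cong[of _ _ card])

text \<open>If no column started in row 1, \<open>grow\<close> at \<open>i = 1\<close> would demand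
  rows at position 0. For \<open>m = 1\<close>, where \<open>grow\<close> has no instance, every
  column starts in row 1.\<close>

lemma q_1: "1 \<le> q 1"
proof (cases "m = 1")
  case True
  have "{w \<in> {m..<m+n}. G w \<le> q 0} = {m..<m+n}"
    unfolding q.simps(1) using G_col True by auto
  then have "q (Suc 0) = n" using q_even[of 0] by simp
  then show ?thesis using n_pos by simp
next
  case False
  show ?thesis
  proof (rule ccontr)
    assume "\<not> 1 \<le> q 1"
    moreover have "q 1 = card {w \<in> {m..<m+n}. G w \<le> 1}"
      using q_even[OF dvd_0_right] by (simp only: q.simps(1) One_nat_def)
    ultimately have *: "card {w \<in> {m..<m+n}. G w \<le> 1} = 0" by linarith
    have "1 \<in> {1..<m}" using False m_pos by simp
    from grow[OF this] have "card {v \<in> {0..<m}. G v \<le> 0} > 1" by (simp only: *)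
    moreover have "\<not> G v \<le> 0" if "v \<in> {0..<m}" for v using G_pos[of v] that by simp
    then have "{v \<in> {0..<m}. G v \<le> 0} = {}" by blast
    ultimately show False by (metis card.empty not_less_zero)
  qed
qed

text \<open>The step from one value of \<open>q\<close> to the next is monotone, so it suffices to
  start the induction, where label 0 at position 1 is burnt.\<close>

lemma q_step: "q t \<le> q (Suc (Suc t))"
proof (induction t)
  case 0
  have "0 \<in> {v \<in> {0..<m}. G v \<le> q (Suc 0)}" using q_1 G_0 m_pos by simp
  then have "{0} \<subseteq> {v \<in> {0..<m}. G v \<le> q (Suc 0)}" by simp
  from card_mono[OF _ this] have "card {0} \<le> card {v \<in> {0..<m}. G v \<le> q (Suc 0)}" by simp
  then show ?case using q_odd[of "Suc 0"] by simp
next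
  case (Suc t)
  show ?case
    unfolding q.simps(2)[of t] q.simps(2)[of "Suc (Suc t)"]
    using Suc by (intro card_mono) auto
qed

lemma q_mono:
  assumes "s \<le> t" "even s = even t"
  shows "q s \<le> q t"
proof -
  have "q s \<le> q (s + 2 * k)" for k
    by (induction k) (auto intro: order_trans[OF _ q_step])
  moreover obtain k where "t = s + 2 * k"
    using assms by (metis dvdE even_diff_nat le_add_diff_inverse even_add)
  ultimately show ?thesis by simp
qed

lemma q_pos: "1 \<le> q t"
  using q_mono[of "t mod 2" t] q_1 by (cases "even t") (auto simp: odd_iff_mod_2_eq_one simp del: One_nat_def)

lemma q_full: "min m (Suc k) \<le> q (2 * k)"
proof (induction k)
  case (Suc k)
  show ?case
  proof (cases "q (2 * k) < m")
    case True
    then have "q (2 * k) < q (Suc (Suc (2 * k)))"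
      using grow[of "q (2 * k)"] q_pos[of "2 * k"] q_odd[of "Suc (2 * k)"] q_even[of "2 * k"]
      by simp
    then show ?thesis using Suc by simp
  next
    case False
    then show ?thesis using q_step[of "2 * k"] by simp
  qed
qed simp

text \<open>The time at which \<open>x\<close> burns: the first step of the right parity at which
  its position is reached. Requiring \<open>0 < t\<close> keeps \<open>t - 1\<close> from being
  truncated, and label 0 burns at time 0.\<close>

definition \<tau> :: "nat \<Rightarrow> nat" where
  "\<tau> x = (if x = 0 then 0 else LEAST t. 0 < t \<and> (even t \<longleftrightarrow> x < m) \<and> G x \<le> q (t - 1))"

text \<open>Each double step of \<open>q\<close> gains a row until all \<open>m\<close> rows are burnt, so every label burns.\<close>

lemma burns:
  assumes "x < m + n"
  shows "\<exists>t>0. (even t \<longleftrightarrow> x < m) \<and> G x \<le> q (t - 1)"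
proof -
  have full: "m \<le> q (2 * m)" using q_full[of m] by simp
  have col: "G w \<le> q (2 * m)" if "w \<in> {m..<m+n}" for w using G_col[OF that] full by simp
  show ?thesis
  proof (cases "x < m")
    case False
    then have "x \<in> {m..<m+n}" using assms by simp
    then show ?thesis using col False by (intro exI[of _ "Suc (2 * m)"]) simp
  next
    case True
    have "{w \<in> {m..<m+n}. G w \<le> q (2 * m)} = {m..<m+n}" using col by auto
    then have "q (Suc (2 * m)) = n" using q_even[of "2 * m"] by simp
    then show ?thesis
      using G_row[OF True] True by (intro exI[of _ "Suc (Suc (2 * m))"]) simp
  qed
qed

lemma tau_prop:
  assumes "x < m + n" "x \<noteq> 0"
  shows "0 < \<tau> x \<and> (even (\<tau> x) \<longleftrightarrow> x < m) \<and> G x \<le> q (\<tau> x - 1)"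
  using LeastI_ex[OF burns[OF assms(1)]] assms(2) by (simp add: \<tau>_def)

lemma tau_zero: "\<tau> 0 = 0"
  by (simp add: \<tau>_def)

lemma tau_parity: "x < m + n \<Longrightarrow> even (\<tau> x) \<longleftrightarrow> x < m"
  using tau_prop[of x] m_pos by (cases "x = 0") (auto simp: tau_zero)

text \<open>The counterpart of \<open>F_le_cnt_iff\<close>: a label reached at step \<open>t\<close>
  has burnt by time \<open>t + 1\<close>, and since \<open>q\<close> grows in steps of two a label
  once reached stays reached.\<close>

lemma G_le_iff:
  assumes "x < m + n" "even (Suc t) \<longleftrightarrow> x < m"
  shows "G x \<le> q t \<longleftrightarrow> \<tau> x \<le> Suc t"
proof (cases "x = 0")
  case True
  then show ?thesis using G_0 q_pos tau_zero by simp
next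
  case False
  show ?thesis
  proof
    assume "G x \<le> q t"
    then have "(LEAST t. 0 < t \<and> (even t \<longleftrightarrow> x < m) \<and> G x \<le> q (t - 1)) \<le> Suc t"
      using assms(2) by (intro Least_le) (simp del: even_Suc)
    then show "\<tau> x \<le> Suc t" using False by (simp add: \<tau>_def)
  next
    assume le: "\<tau> x \<le> Suc t"
    have p: "0 < \<tau> x" "even (\<tau> x) \<longleftrightarrow> x < m" "G x \<le> q (\<tau> x - 1)" using tau_prop[OF assms(1) False] by auto
    have "\<tau> x - 1 \<le> t" using le by simp
    moreover have "even (\<tau> x - 1) = even t" using p(1,2) assms(2) by auto
    ultimately show "G x \<le> q t" using q_mono[of "\<tau> x - 1" t] p(3) by linarith
  qed
qed

lemma q_eq: "q t = card {y. y < m + n \<and> \<tau> y \<le> t \<and> even (\<tau> y) = even t}"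
proof (cases t)
  case 0
  have "{y. y < m + n \<and> \<tau> y \<le> 0 \<and> even (\<tau> y) = even 0} = {0}"
    using tau_prop tau_zero m_pos by force
  then show ?thesis using 0 by simp
next
  case (Suc u)
  have "x < m + n \<and> (even (Suc u) \<longleftrightarrow> x < m) \<and> G x \<le> q u \<longleftrightarrow>
      x < m + n \<and> \<tau> x \<le> Suc u \<and> even (\<tau> x) = even (Suc u)" for x
    using G_le_iff[of x u] tau_parity[of x] by blast
  then show ?thesis using Suc by (simp add: q.simps(2))
qed

text \<open>For predecessors: if \<open>x\<close> burns at time \<open>t + 2\<close> and nothing
  burns at time \<open>t + 1\<close>, then \<open>q (t + 1) = q (t - 1)\<close> and \<open>x\<close>
  would have burnt by time \<open>t\<close>. At \<open>t = 0\<close> the count \<open>q 1\<close>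
  would vanish instead.\<close>

lemma layering: "layering m n \<tau>"
proof
  show "1 \<le> m" "1 \<le> n" by (rule m_pos n_pos)+
  fix x assume x: "x < m + n"
  show "even (\<tau> x) = (x < m)" using tau_parity[OF x] .
  show "\<tau> x = 0 \<longleftrightarrow> x = 0" using tau_prop[OF x] tau_zero by (metis not_less_zero)
  assume x0: "x \<noteq> 0"
  then have p: "0 < \<tau> x" "even (\<tau> x) \<longleftrightarrow> x < m" "G x \<le> q (\<tau> x - 1)" using tau_prop[OF x] by auto
  show "\<exists>y < m + n. Suc (\<tau> y) = \<tau> x"
  proof (cases "\<tau> x = 1")
    case True
    then show ?thesis using tau_zero m_pos by (intro exI[of _ 0]) simp
  next
    case False
    then obtain t where t: "\<tau> x = Suc (Suc t)" using p(1) by (cases "\<tau> x"; cases "\<tau> x - 1") auto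
    show ?thesis
    proof (rule ccontr)
      assume no: "\<not> (\<exists>y < m + n. Suc (\<tau> y) = \<tau> x)"
      have sub: "{y. y < m + n \<and> \<tau> y \<le> Suc t \<and> even (\<tau> y) = even (Suc t)} \<subseteq>
          {y. y < m + n \<and> \<tau> y \<le> t - 1 \<and> even (\<tau> y) = even (Suc t)}"
      proof clarify
        fix y assume y: "y < m + n" "\<tau> y \<le> Suc t" "even (\<tau> y) = even (Suc t)"
        then have "\<tau> y \<noteq> Suc t" "\<tau> y \<noteq> t" using no t by auto
        then show "\<tau> y \<le> t - 1" using y by simp
      qed
      show False
      proof (cases t)
        case 0
        then have "{y. y < m + n \<and> \<tau> y \<le> Suc t \<and> even (\<tau> y) = even (Suc t)} = {}" using sub by auto
        then have "q (Suc t) = 0" unfolding q_eq by simp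
        then show False using q_pos[of "Suc t"] by simp
      next
        case (Suc u)
        have "q (Suc t) \<le> q u"
          unfolding q_eq using sub Suc by (intro card_mono) auto
        then have "G x \<le> q u" using p(3) t by simp
        then have "\<tau> x \<le> Suc u" using G_le_iff[OF x, of u] p(2) t Suc by simp
        then show False using t Suc by simp
      qed
    qed
  qed
qed

text \<open>The surplus is how far the position of \<open>x\<close> falls short of the bound at
  which it burns. It is less than the layer because \<open>x\<close> was not yet reached two steps
  earlier.\<close>

lemma surplus_exists: "\<exists>s. layering.admissible m n \<tau> s \<and> (\<forall>x < m + n. layering.F m n \<tau> s x = G x)"
proof -
  interpret L: layering m n \<tau> by (rule layering)
  have qc: "q t = L.cnt t" for t unfolding L.cnt_def by (rule q_eq)
  define s where "s x = (if x < m + n then q (\<tau> x - 1) - G x else 0)" for x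
  have "L.F s x = G x" if x: "x < m + n" for x
  proof (cases "x = 0")
    case True
    then show ?thesis using G_0 m_pos by (simp add: L.F_def s_def tau_zero L.cnt_0)
  next
    case False
    then show ?thesis using tau_prop[OF x] x by (simp add: L.F_def s_def qc)
  qed
  moreover have "L.admissible s"
    unfolding L.admissible_def
  proof (intro conjI allI impI)
    show "s 0 = 0" using G_0 by (simp add: s_def tau_zero)
    fix x assume x: "x < m + n" "x \<noteq> 0"
    then have p: "0 < \<tau> x" "even (\<tau> x) \<longleftrightarrow> x < m" "G x \<le> q (\<tau> x - 1)" using tau_prop[OF x(1)] by auto
    then obtain t where t: "\<tau> x = Suc t" by (cases "\<tau> x") auto
    show "s x < layer (m + n) \<tau> x"
    proof (cases "t \<le> 1")
      case True
      \<comment> \<open>At levels 1 and 2 there is no step two earlier; all of \<open>q t\<close>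
        belongs to one level, and positivity of \<open>G\<close> gives the strict bound.\<close>
      have "q t \<le> layer (m + n) \<tau> x"
        unfolding q_eq layer_def t using True by (intro card_mono) (auto simp: le_Suc_eq)
      then show ?thesis using G_pos[OF x(1)] q_pos[of t] t x(1) by (simp add: s_def)
    next
      case False
      then obtain u where u: "t = Suc (Suc u)" by (cases t; cases "t - 1") auto
      have "\<not> G x \<le> q u" using G_le_iff[OF x(1), of u] p(2) t u by simp
      moreover have "layer (m + n) \<tau> x = card {y. y < m + n \<and> \<tau> y = Suc (Suc u)}"
        by (simp add: layer_def t u)
      ultimately show ?thesis
        using L.cnt_step[of u] p(3) x(1) t u by (simp add: s_def qc)
    qed
  qed
  ultimately show ?thesis by blast
qed

end

text \<open>The position function of a labelled polyomino satisfies the burning conditions, and the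
  burning times and shortfalls supply level and surplus.\<close>

lemma LPara_layering:
  assumes D: "D \<in> LPara m n" and mn: "1 \<le> m" "1 \<le> n"
  shows "\<exists>\<tau> s. layering m n \<tau> \<and> layering.admissible m n \<tau> s \<and> D = assemble m n (layering.F m n \<tau> s)"
proof -
  obtain P r c where D': "D = (P, r, c)" by (cases D)
  have P: "P \<in> Para m n" and br: "bij_betw r {1..m} {0..<m}" and bc: "bij_betw c {1..n} {m..<m+n}"
    and er: "r \<in> extensional {1..m}" and ec: "c \<in> extensional {1..n}" and r1: "r 1 = 0"
    and tr: "\<And>i i'. i \<in> {1..m} \<Longrightarrow> i' \<in> {1..m} \<Longrightarrow> i < i' \<Longrightarrow> leftmost n P i = leftmost n P i' \<Longrightarrow> r i < r i'"
    and tc: "\<And>i i'. i \<in> {1..n} \<Longrightarrow> i' \<in> {1..n} \<Longrightarrow> i < i' \<Longrightarrow> topmost m P i = topmost m P i' \<Longrightarrow> c i < c i'"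
    using D unfolding D' LPara_def row_labelling_def col_labelling_def by blast+
  let ?a = "leftmost n P" and ?b = "topmost m P"
  define G where "G x = (if x < m then ?a (inv_into {1..m} r x) else ?b (inv_into {1..n} c x))" for x
  note bd = Para_boundary(1)[OF P mn]
  have Gr: "G (r i) = ?a i" if "i \<in> {1..m}" for i
    using bij_betw_apply[OF br that] bij_betw_inv_into_left[OF br that] by (simp add: G_def)
  have Gc: "G (c j) = ?b j" if "j \<in> {1..n}" for j
    using bij_betw_apply[OF bc that] bij_betw_inv_into_left[OF bc that] by (simp add: G_def)
  have ma: "mono_on {1..m} ?a" and mb: "mono_on {1..n} ?b"
    and aR: "\<And>i. i \<in> {1..m} \<Longrightarrow> ?a i \<in> {1..n}" and bR: "\<And>j. j \<in> {1..n} \<Longrightarrow> ?b j \<in> {1..m}"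
    and a1: "?a 1 = 1" and ba: "\<And>i. i \<in> {1..<m} \<Longrightarrow> ?b (?a (Suc i)) \<le> i"
    using bd unfolding boundary_def by blast+
  have sr: "sorts m {0..<m} G r"
    unfolding sorts_def
  proof (intro conjI br er ballI impI)
    fix i i' assume i: "i \<in> {1..m}" "i' \<in> {1..m}" "i < i'"
    then have "?a i \<le> ?a i'" by (intro mono_onD[OF ma]) auto
    then show "lex_less G (r i) (r i')" using tr[OF i] Gr i by (auto simp: lex_less_def)
  qed
  have sc: "sorts n {m..<m+n} G c"
    unfolding sorts_def
  proof (intro conjI bc ec ballI impI)
    fix i i' assume i: "i \<in> {1..n}" "i' \<in> {1..n}" "i < i'"
    then have "?b i \<le> ?b i'" by (intro mono_onD[OF mb]) auto
    then show "lex_less G (c i) (c i')" using tc[OF i] Gc i by (auto simp: lex_less_def)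
  qed
  have "P = polyomino m n (\<lambda>i. G (r i)) (\<lambda>j. G (c j))"
    using Para_boundary(2)[OF P mn] polyomino_cong[of m "\<lambda>i. G (r i)" ?a n "\<lambda>j. G (c j)" ?b] Gr Gc by simp
  then have DG: "D = assemble m n G"
    using sorter_eq[OF sr] sorter_eq[OF sc] by (simp add: D' assemble_def)
  have row: "\<exists>i\<in>{1..m}. r i = v" if "v < m" for v
    using br that by (metis atLeast0LessThan bij_betw_imp_surj_on imageE lessThan_iff)
  have col: "\<exists>j\<in>{1..n}. c j = w" if "w \<in> {m..<m+n}" for w
    using bc that by (metis bij_betw_imp_surj_on imageE)
  have rowR: "G v \<in> {1..n}" if "v < m" for v using row[OF that] Gr aR by metis
  have colR: "G w \<in> {1..m}" if "w \<in> {m..<m+n}" for w using col[OF that] Gc bR by metis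
  interpret burning m n G
  proof
    show "1 \<le> m" "1 \<le> n" by fact+
    show "G 0 = 1" using Gr[of 1] r1 a1 mn by simp
    show "1 \<le> G x" if "x < m + n" for x
      using rowR[of x] colR[of x] that by (cases "x < m") auto
    show "G v \<le> n" if "v < m" for v using rowR[OF that] by simp
    show "G w \<le> m" if "w \<in> {m..<m+n}" for w using colR[OF that] by simp
    \<comment> \<open>Column \<open>?a (Suc i)\<close> starts at or above row \<open>i\<close>, so
      it and all columns to its left are counted; hence row \<open>Suc i\<close> and all rows above
      it are counted.\<close>
    show "i < card {v \<in> {0..<m}. G v \<le> card {w \<in> {m..<m+n}. G w \<le> i}}" if i: "i \<in> {1..<m}" for i
    proof -
      have Si: "Suc i \<in> {1..m}" using i by auto
      have "G (c (?a (Suc i))) \<le> i" using ba[OF i] Gc[OF aR[OF Si]] by simp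
      then have "?a (Suc i) \<le> card {w \<in> {m..<m+n}. G w \<le> i}"
        using position_le[OF bc sorts_mono[OF sc] aR[OF Si]] by simp
      then have "G (r (Suc i)) \<le> card {w \<in> {m..<m+n}. G w \<le> i}" using Gr[OF Si] by simp
      then show ?thesis using position_le[OF br sorts_mono[OF sr] Si] by simp
    qed
  qed
  obtain s where s: "layering.admissible m n \<tau> s" "\<And>x. x < m + n \<Longrightarrow> layering.F m n \<tau> s x = G x"
    using surplus_exists by blast
  then have "D = assemble m n (layering.F m n \<tau> s)"
    unfolding DG by (intro assemble_cong) simp
  then show ?thesis using layering s(1) by blast
qed

section \<open>EW-tableaux and layerings\<close>

context layering
begin

lemma ew_tableau_entry:
  assumes "v < m" "w \<in> {m..<m+n}"
  shows "ew_tableau m n \<tau> (v + 1) (w + 1 - m) = of_bool (\<tau> v < \<tau> w)"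
proof -
  have "w + 1 - m + m - 1 = w" "w + 1 - m \<in> {1..n}" "v + 1 \<in> {1..m}" using assms by auto
  then show ?thesis by (simp add: ew_tableau_def)
qed

lemma tau_neq: "v < m \<Longrightarrow> w \<in> {m..<m+n} \<Longrightarrow> \<tau> v \<noteq> \<tau> w"
  using parity_sides by metis

text \<open>A forbidden pattern would give a cycle of inequalities between levels, and a row other
  than the first has a 0 at a predecessor.\<close>

lemma ew_tableau_EW: "ew_tableau m n \<tau> \<in> EW m n"
proof -
  let ?T = "ew_tableau m n \<tau>"
  have T: "?T i j = of_bool (\<tau> (i - 1) < \<tau> (j + m - 1))" if "i \<in> {1..m}" "j \<in> {1..n}" for i j
    using that by (simp add: ew_tableau_def)
  have col: "j + m - 1 \<in> {m..<m+n}" if "j \<in> {1..n}" for j using that by auto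
  have "?T \<in> tableaux m n" by (auto simp: tableaux_def ew_tableau_def)
  moreover have "?T 1 j = 1" if j: "j \<in> {1..n}" for j
  proof -
    have "odd (\<tau> (j + m - 1))" using parity_sides(2)[OF col[OF j]] .
    then show ?thesis using T[of 1 j] m_pos j tau_0 by (simp add: odd_pos)
  qed
  moreover have "\<exists>j\<in>{1..n}. ?T i j = 0" if i: "i \<in> {2..m}" for i
  proof -
    have "i - 1 < m" "i - 1 \<noteq> 0" using i by auto
    then obtain y where y: "y \<in> {m..<m+n}" "Suc (\<tau> y) = \<tau> (i - 1)" using pred_row by blast
    then have "y + 1 - m \<in> {1..n}" "y + 1 - m + m - 1 = y" by auto
    moreover have "i \<in> {1..m}" using i by auto
    ultimately have "?T i (y + 1 - m) = 0" using T[of i "y + 1 - m"] y by simp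
    then show ?thesis using \<open>y + 1 - m \<in> {1..n}\<close> by blast
  qed
  moreover have False
    if *: "i \<in> {1..m}" "i' \<in> {1..m}" "k \<in> {1..n}" "k' \<in> {1..n}"
      "?T i k = 0" "?T i' k' = 0" "?T i k' = 1" "?T i' k = 1" for i i' k k'
  proof -
    have "\<not> \<tau> (i - 1) < \<tau> (k + m - 1)" "\<not> \<tau> (i' - 1) < \<tau> (k' + m - 1)"
      using *(5,6) T[OF *(1,3)] T[OF *(2,4)] by auto
    moreover have "\<tau> (i - 1) < \<tau> (k' + m - 1)" "\<tau> (i' - 1) < \<tau> (k + m - 1)"
      using *(7,8) T[OF *(1,4)] T[OF *(2,3)] by (metis of_bool_eq_1_iff)+
    ultimately show False by linarith
  qed
  ultimately show ?thesis unfolding EW_def by blast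
qed

text \<open>Here the edge goes from column \<open>w\<close> to row \<open>x\<close>. Corner support
  is a detour of length 3 through a row and another column, so it forces the levels to differ by at
  least 3; conversely, two steps back along predecessors of \<open>x\<close> give such a
  detour.\<close>

lemma cornersupport_zero_iff:
  assumes x: "x < m" and w: "w \<in> {m..<m+n}" and lt: "\<tau> w < \<tau> x"
  shows "cornersupport m n (ew_tableau m n \<tau>) (x + 1) (w + 1 - m) \<longleftrightarrow> Suc (\<tau> w) \<noteq> \<tau> x"
proof -
  let ?T = "ew_tableau m n \<tau>"
  have T0: "?T (x + 1) (w + 1 - m) = 0" using ew_tableau_entry[OF x w] lt by simp
  show ?thesis
  proof
    assume "cornersupport m n ?T (x + 1) (w + 1 - m)"
    then obtain i k where ik: "i \<in> {1..m}" "k \<in> {1..n}" "?T i k = 1" "?T i (w + 1 - m) = 0" "?T (x + 1) k = 0"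
      unfolding cornersupport_def T0 by auto
    obtain v where v: "i = v + 1" "v < m" using ik(1) by (cases i) auto
    define w' where "w' = k + m - 1"
    have w': "k = w' + 1 - m" "w' \<in> {m..<m+n}" using ik(2) by (auto simp: w'_def)
    have "\<tau> v < \<tau> w'" using ik(3) ew_tableau_entry[OF v(2) w'(2)] v(1) w'(1) by (metis of_bool_eq_1_iff)
    moreover have "\<not> \<tau> v < \<tau> w" using ik(4) ew_tableau_entry[OF v(2) w] v(1) by (metis of_bool_eq_0_iff)
    moreover have "\<not> \<tau> x < \<tau> w'" using ik(5) ew_tableau_entry[OF x w'(2)] w'(1) by (metis of_bool_eq_0_iff)
    ultimately show "Suc (\<tau> w) \<noteq> \<tau> x" using tau_neq[OF v(2) w] tau_neq[OF x w'(2)] by linarith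
  next
    assume ne: "Suc (\<tau> w) \<noteq> \<tau> x"
    have "x \<noteq> 0" using lt tau_0 by (metis not_less_zero)
    then obtain w' where w': "w' \<in> {m..<m+n}" "Suc (\<tau> w') = \<tau> x" using pred_row[OF x] by blast
    then obtain v where v: "v < m" "Suc (\<tau> v) = \<tau> w'" using pred_col by blast
    \<comment> \<open>The level of \<open>v\<close> is \<open>\<tau> x - 2\<close>; that of
      \<open>w\<close> is not \<open>\<tau> x - 1\<close> by assumption and not
      \<open>\<tau> x - 2\<close> by parity.\<close>
    have "\<tau> w < \<tau> v" using ne lt w' v tau_neq[OF v(1) w] by linarith
    then have "?T (v + 1) (w' + 1 - m) = 1" "?T (v + 1) (w + 1 - m) = 0" "?T (x + 1) (w' + 1 - m) = 0"
      using ew_tableau_entry[OF v(1) w'(1)] ew_tableau_entry[OF v(1) w] ew_tableau_entry[OF x w'(1)] v w'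
      by simp_all
    moreover have "v + 1 \<in> {1..m}" "w' + 1 - m \<in> {1..n}" using v w' by auto
    moreover have "v + 1 \<noteq> x + 1" using v w' by auto
    moreover have "w' + 1 - m \<noteq> w + 1 - m"
    proof -
      have "w' \<noteq> w" using \<open>\<tau> w < \<tau> v\<close> v by auto
      then show ?thesis using w' w by auto
    qed
    ultimately show "cornersupport m n ?T (x + 1) (w + 1 - m)"
      unfolding cornersupport_def T0 diff_zero by blast
  qed
qed

text \<open>The same detour argument for an edge from row \<open>v\<close> to column
  \<open>x\<close>, through a column and another row.\<close>

lemma cornersupport_one_iff:
  assumes v: "v < m" and x: "x \<in> {m..<m+n}" and lt: "\<tau> v < \<tau> x"
  shows "cornersupport m n (ew_tableau m n \<tau>) (v + 1) (x + 1 - m) \<longleftrightarrow> Suc (\<tau> v) \<noteq> \<tau> x"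
proof -
  let ?T = "ew_tableau m n \<tau>"
  have T1: "?T (v + 1) (x + 1 - m) = 1" using ew_tableau_entry[OF v x] lt by simp
  show ?thesis
  proof
    assume "cornersupport m n ?T (v + 1) (x + 1 - m)"
    then obtain i k where ik: "i \<in> {1..m}" "k \<in> {1..n}" "?T i k = 0" "?T i (x + 1 - m) = 1" "?T (v + 1) k = 1"
      unfolding cornersupport_def T1 by auto
    obtain v' where v': "i = v' + 1" "v' < m" using ik(1) by (cases i) auto
    define w where "w = k + m - 1"
    have w: "k = w + 1 - m" "w \<in> {m..<m+n}" using ik(2) by (auto simp: w_def)
    have "\<not> \<tau> v' < \<tau> w" using ik(3) ew_tableau_entry[OF v'(2) w(2)] v'(1) w(1) by (metis of_bool_eq_0_iff)
    moreover have "\<tau> v' < \<tau> x" using ik(4) ew_tableau_entry[OF v'(2) x] v'(1) by (metis of_bool_eq_1_iff)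
    moreover have "\<tau> v < \<tau> w" using ik(5) ew_tableau_entry[OF v w(2)] w(1) by (metis of_bool_eq_1_iff)
    ultimately show "Suc (\<tau> v) \<noteq> \<tau> x" by linarith
  next
    assume ne: "Suc (\<tau> v) \<noteq> \<tau> x"
    obtain v' where v': "v' < m" "Suc (\<tau> v') = \<tau> x" using pred_col[OF x] by blast
    have "\<tau> v < \<tau> v'" using ne lt v' by linarith
    then have "v' \<noteq> 0" using tau_0 by (metis not_less_zero)
    then obtain w where w: "w \<in> {m..<m+n}" "Suc (\<tau> w) = \<tau> v'" using pred_row[OF v'(1)] by blast
    have lt2: "\<tau> v < \<tau> w" using w \<open>\<tau> v < \<tau> v'\<close> tau_neq[OF v w(1)] by linarith
    then have "?T (v' + 1) (w + 1 - m) = 0" "?T (v' + 1) (x + 1 - m) = 1" "?T (v + 1) (w + 1 - m) = 1"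
      using ew_tableau_entry[OF v'(1) w(1)] ew_tableau_entry[OF v'(1) x] ew_tableau_entry[OF v w(1)] v' w
      by simp_all
    moreover have "v' + 1 \<in> {1..m}" "w + 1 - m \<in> {1..n}" using v' w by auto
    moreover have "v' + 1 \<noteq> v + 1" using \<open>\<tau> v < \<tau> v'\<close> by auto
    moreover have "w + 1 - m \<noteq> x + 1 - m"
    proof -
      have "w \<noteq> x" using v' w by auto
      then show ?thesis using w x by auto
    qed
    ultimately show "cornersupport m n ?T (v + 1) (x + 1 - m)"
      unfolding cornersupport_def T1 diff_self_eq_0 by blast
  qed
qed

text \<open>The entries counted by \<open>eta\<close> are the edges into \<open>x\<close> from one
  level below. The shift between labels and row or column indices is a bijection.\<close>

lemma eta_eq_layer:
  assumes x: "x < m + n" "x \<noteq> 0"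
  shows "eta m n (ew_tableau m n \<tau>) x = layer (m + n) \<tau> x"
proof -
  let ?T = "ew_tableau m n \<tau>" and ?L = "{y. y < m + n \<and> Suc (\<tau> y) = \<tau> x}"
  show ?thesis
  proof (cases "x < m")
    case True
    have L: "y \<in> {m..<m+n}" if "y \<in> ?L" for y
    proof -
      have "odd (\<tau> y)" using that parity_sides(1)[OF True] by (metis (mono_tags) even_Suc mem_Collect_eq)
      then show ?thesis using that parity[of y] by auto
    qed
    have "?T (x + 1) (y + 1 - m) = 0 \<and> \<not> cornersupport m n ?T (x + 1) (y + 1 - m) \<longleftrightarrow> y \<in> ?L"
      if y: "y \<in> {m..<m+n}" for y
      using ew_tableau_entry[OF True y] cornersupport_zero_iff[OF True y] tau_neq[OF True y] y
      by (cases "\<tau> y < \<tau> x") auto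
    then have "bij_betw (\<lambda>y. y + 1 - m) ?L {k \<in> {1..n}. ?T (x + 1) k = 0 \<and> \<not> cornersupport m n ?T (x + 1) k}"
    proof (intro bij_betwI[where g = "\<lambda>k. k + m - 1"] Pi_I)
      fix y assume iff: "\<And>y. y \<in> {m..<m+n} \<Longrightarrow>
          ?T (x + 1) (y + 1 - m) = 0 \<and> \<not> cornersupport m n ?T (x + 1) (y + 1 - m) \<longleftrightarrow> y \<in> ?L"
      show "y + 1 - m \<in> {k \<in> {1..n}. ?T (x + 1) k = 0 \<and> \<not> cornersupport m n ?T (x + 1) k}" if "y \<in> ?L"
        using iff[OF L[OF that]] that L[OF that] by auto
      show "y + m - 1 \<in> ?L" if y: "y \<in> {k \<in> {1..n}. ?T (x + 1) k = 0 \<and> \<not> cornersupport m n ?T (x + 1) k}"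
      proof -
        have "y + m - 1 \<in> {m..<m+n}" "y + m - 1 + 1 - m = y" using y by auto
        then show ?thesis using iff[of "y + m - 1"] y by simp
      qed
      show "y + 1 - m + m - 1 = y" if "y \<in> ?L" using L[OF that] by auto
    qed auto
    from bij_betw_same_card[OF this] show ?thesis using True unfolding eta_def layer_def by simp
  next
    case False
    then have xc: "x \<in> {m..<m+n}" using x by simp
    have L: "y < m" if "y \<in> ?L" for y
    proof -
      have "even (\<tau> y)" using that parity_sides(2)[OF xc] by (metis (mono_tags) even_Suc mem_Collect_eq)
      then show ?thesis using that parity[of y] by auto
    qed
    have iff: "?T (y + 1) (x + 1 - m) = 1 \<and> \<not> cornersupport m n ?T (y + 1) (x + 1 - m) \<longleftrightarrow> y \<in> ?L"
      if y: "y < m" for y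
      using ew_tableau_entry[OF y xc] cornersupport_one_iff[OF y xc] y
      by (cases "\<tau> y < \<tau> x") auto
    have "bij_betw Suc ?L {j \<in> {1..m}. ?T j (x + 1 - m) = 1 \<and> \<not> cornersupport m n ?T j (x + 1 - m)}"
    proof (intro bij_betwI[where g = "\<lambda>k. k - 1"] Pi_I)
      fix y
      show "Suc y \<in> {j \<in> {1..m}. ?T j (x + 1 - m) = 1 \<and> \<not> cornersupport m n ?T j (x + 1 - m)}" if "y \<in> ?L"
        using iff[OF L[OF that]] that L[OF that] by auto
      show "y - 1 \<in> ?L" if y: "y \<in> {j \<in> {1..m}. ?T j (x + 1 - m) = 1 \<and> \<not> cornersupport m n ?T j (x + 1 - m)}"
      proof -
        have "y - 1 < m" "y - 1 + 1 = y" using y by auto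
        then show ?thesis using iff[of "y - 1"] y by simp
      qed
    qed auto
    from bij_betw_same_card[OF this] show ?thesis using False unfolding eta_def layer_def by simp
  qed
qed

end

text \<open>
  The columns of an EW-tableau form a chain under inclusion of their sets of 1s. The layer of a column
  is its dense rank \<open>\<kappa>\<close> in this chain, that of a row the number \<open>\<rho>\<close> of distinct columns on its 0s.
\<close>

lemma EW_layering:
  assumes T: "T \<in> EW m n" and mn: "1 \<le> m" "1 \<le> n"
  shows "\<exists>\<tau>. layering m n \<tau> \<and> T = ew_tableau m n \<tau>"
proof -
  have tab: "T \<in> tableaux m n" and row1: "\<And>j. j \<in> {1..n} \<Longrightarrow> T 1 j = 1"
    and zero: "\<And>i. i \<in> {2..m} \<Longrightarrow> \<exists>j\<in>{1..n}. T i j = 0"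
    and noswap: "\<And>i i' k k'. i \<in> {1..m} \<Longrightarrow> i' \<in> {1..m} \<Longrightarrow> k \<in> {1..n} \<Longrightarrow> k' \<in> {1..n} \<Longrightarrow> i \<noteq> i' \<Longrightarrow> k \<noteq> k' \<Longrightarrow>
      T i k = 0 \<Longrightarrow> T i' k' = 0 \<Longrightarrow> T i k' = 1 \<Longrightarrow> T i' k = 1 \<Longrightarrow> False"
    using T unfolding EW_def by blast+
  have bin: "T i j = 1 \<longleftrightarrow> T i j \<noteq> 0" for i j
    using tableaux_nonzero[OF tab, of i j] by auto
  \<comment> \<open>The columns form a chain under inclusion of their 1s, so sizes suffice to
    compare them.\<close>
  define U where "U j = card {i \<in> {1..m}. T i j = 1}" for j
  have U_less: "U j < U j'"
    if ij: "i \<in> {1..m}" "j \<in> {1..n}" "j' \<in> {1..n}" and T0: "T i j = 0" and T1: "T i j' = 1" for i j j'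
    unfolding U_def
  proof (rule psubset_card_mono)
    have "T i' j' = 1" if i': "i' \<in> {1..m}" "T i' j = 1" for i'
    proof (rule ccontr)
      assume "T i' j' \<noteq> 1"
      then have "T i' j' = 0" using bin by blast
      moreover have "i \<noteq> i'" "j \<noteq> j'" using that T0 T1 by auto
      ultimately show False using noswap[OF ij(1) i'(1) ij(2,3)] T0 T1 i'(2) by blast
    qed
    moreover have "i \<in> {i \<in> {1..m}. T i j' = 1}" "i \<notin> {i \<in> {1..m}. T i j = 1}" using ij T0 T1 by auto
    ultimately show "{i \<in> {1..m}. T i j = 1} \<subset> {i \<in> {1..m}. T i j' = 1}" by blast
  qed simp
  define below where "below j = {j' \<in> {1..n}. U j' \<le> U j}" for j
  define zeros where "zeros i = {j \<in> {1..n}. T i j = 0}" for i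
  define \<kappa> where "\<kappa> j = card (U ` below j)" for j
  define \<rho> where "\<rho> i = card (U ` zeros i)" for i
  have fin: "finite (below j)" "finite (zeros i)" for i j by (auto simp: below_def zeros_def)
  have kappa_pos: "1 \<le> \<kappa> j" if "j \<in> {1..n}" for j
  proof -
    have "j \<in> below j" using that by (simp add: below_def)
    then have "\<kappa> j \<noteq> 0" using fin by (auto simp: \<kappa>_def)
    then show ?thesis by simp
  qed
  \<comment> \<open>The zeros of a row are closed under passing to smaller columns, so comparing the
    dense rank of a column with the number of distinct sizes on the zeros decides the entry.\<close>
  have key: "T i j = 0 \<longleftrightarrow> \<kappa> j \<le> \<rho> i" if ij: "i \<in> {1..m}" "j \<in> {1..n}" for i j
  proof
    assume T0: "T i j = 0"
    have "T i j' = 0" if "j' \<in> {1..n}" "U j' \<le> U j" for j'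
      using U_less[OF ij that(1) T0] bin[of i j'] that(2) by auto
    then have "below j \<subseteq> zeros i" by (auto simp: below_def zeros_def)
    then show "\<kappa> j \<le> \<rho> i" unfolding \<kappa>_def \<rho>_def using fin by (intro card_mono image_mono) auto
  next
    assume le: "\<kappa> j \<le> \<rho> i"
    show "T i j = 0"
    proof (rule ccontr)
      assume "T i j \<noteq> 0"
      then have T1: "T i j = 1" using bin by blast
      have less: "U j' < U j" if "j' \<in> zeros i" for j'
        using U_less[OF ij(1) _ ij(2) _ T1] that by (simp add: zeros_def)
      then have "zeros i \<subseteq> below j" by (auto simp: below_def zeros_def less_imp_le)
      moreover have "U j \<in> U ` below j" using ij by (simp add: below_def)
      moreover have "U j \<notin> U ` zeros i" using less by (metis imageE less_irrefl)
      ultimately have "U ` zeros i \<subset> U ` below j" by blast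
      then have "\<rho> i < \<kappa> j" unfolding \<kappa>_def \<rho>_def using fin by (intro psubset_card_mono) auto
      then show False using le by simp
    qed
  qed
  \<comment> \<open>Doubling puts rows on even and columns on odd levels, and
    \<open>2 * \<kappa> j - 1 < 2 * \<rho> i\<close> says the same as
    \<open>\<kappa> j \<le> \<rho> i\<close>.\<close>
  define \<tau> where "\<tau> x = (if x < m then 2 * \<rho> (x + 1) else 2 * \<kappa> (x + 1 - m) - 1)" for x
  have tau_row: "\<tau> (i - 1) = 2 * \<rho> i" if "i \<in> {1..m}" for i
    using that by (auto simp: \<tau>_def)
  have tau_col: "\<tau> (j + m - 1) = 2 * \<kappa> j - 1" if "j \<in> {1..n}" for j
    using that by (auto simp: \<tau>_def)
  have "T = ew_tableau m n \<tau>"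
  proof (intro ext)
    fix i j
    show "T i j = ew_tableau m n \<tau> i j"
    proof (cases "i \<in> {1..m} \<and> j \<in> {1..n}")
      case True
      then have "\<tau> (i - 1) < \<tau> (j + m - 1) \<longleftrightarrow> \<not> \<kappa> j \<le> \<rho> i"
        using tau_row[of i] tau_col[of j] kappa_pos[of j] by (simp only:) linarith
      then show ?thesis using key[of i j] True bin[of i j] by (auto simp: ew_tableau_def)
    next
      case False
      then show ?thesis using tableaux_nonzero[OF tab, of i j] by (auto simp: ew_tableau_def)
    qed
  qed
  moreover have "layering m n \<tau>"
  proof
    show "1 \<le> m" "1 \<le> n" by fact+
    fix x assume x: "x < m + n"
    have col: "x + 1 - m \<in> {1..n}" if "\<not> x < m" using x that by auto
    show par: "even (\<tau> x) = (x < m)" using kappa_pos[OF col] by (auto simp: \<tau>_def)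
    have zeros_1: "zeros 1 = {}" using row1 by (auto simp: zeros_def)
    have rho_1: "\<rho> 1 = 0" using zeros_1 by (simp add: \<rho>_def)
    show "\<tau> x = 0 \<longleftrightarrow> x = 0"
    proof
      show "\<tau> x = 0" if "x = 0" using that mn rho_1 by (simp add: \<tau>_def)
      assume t0: "\<tau> x = 0"
      then have xm: "x < m" using par by (metis even_zero)
      then have "\<rho> (x + 1) = 0" using t0 by (simp add: \<tau>_def)
      then have z: "zeros (x + 1) = {}" using fin by (simp add: \<rho>_def)
      show "x = 0"
      proof (rule ccontr)
        assume "x \<noteq> 0"
        then have "x + 1 \<in> {2..m}" using xm by auto
        then obtain j where "j \<in> {1..n}" "T (x + 1) j = 0" using zero by blast
        then have "j \<in> zeros (x + 1)" by (simp add: zeros_def)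
        then show False using z by blast
      qed
    qed
    assume x0: "x \<noteq> 0"
    show "\<exists>y < m + n. Suc (\<tau> y) = \<tau> x"
    proof (cases "x < m")
      case True
      define i where "i = x + 1"
      have i: "i \<in> {2..m}" "i \<in> {1..m}" using True x0 by (auto simp: i_def)
      obtain j where "j \<in> {1..n}" "T i j = 0" using zero[OF i(1)] by blast
      then have "j \<in> zeros i" by (simp add: zeros_def)
      then have "zeros i \<noteq> {}" by blast
      \<comment> \<open>A largest column among the zeros of row \<open>i\<close> has rank
        \<open>\<rho> i\<close>, so it is a predecessor.\<close>
      then have "Max (U ` zeros i) \<in> U ` zeros i" using fin by (intro Max_in) auto
      then obtain j where j: "j \<in> zeros i" "U j = Max (U ` zeros i)" by auto
      then have "\<And>j'. j' \<in> zeros i \<Longrightarrow> U j' \<le> U j" using fin by simp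
      then have "zeros i \<subseteq> below j" by (auto simp: below_def zeros_def)
      then have "\<rho> i \<le> \<kappa> j" unfolding \<kappa>_def \<rho>_def using fin by (intro card_mono image_mono) auto
      moreover have jn: "j \<in> {1..n}" "T i j = 0" using j by (auto simp: zeros_def)
      ultimately have "\<rho> i = \<kappa> j" using key[OF i(2) jn(1)] by simp
      then have "Suc (\<tau> (j + m - 1)) = \<tau> x"
        using tau_col[OF jn(1)] tau_row[OF i(2)] kappa_pos[OF jn(1)] by (simp add: i_def)
      moreover have "j + m - 1 < m + n" using jn by auto
      ultimately show ?thesis by blast
    next
      case False
      define j where "j = x + 1 - m"
      have j: "j \<in> {1..n}" using col[OF False] by (simp add: j_def)
      have tx: "\<tau> x = 2 * \<kappa> j - 1" using False by (simp add: \<tau>_def j_def)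
      \<comment> \<open>A predecessor of column \<open>j\<close> is a row with 1 in \<open>j\<close>
        and 0 in a largest column of \<open>B\<close>: its zeros then realise exactly the sizes in
        \<open>B\<close>. If \<open>B\<close> is empty, the source row serves.\<close>
      define B where "B = {j' \<in> {1..n}. U j' < U j}"
      have finB: "finite B" by (simp add: B_def)
      have "below j = B \<union> {j' \<in> {1..n}. U j' = U j}" by (auto simp: below_def B_def)
      then have "U ` below j = insert (U j) (U ` B)" using j by auto
      moreover have "U j \<notin> U ` B" by (auto simp: B_def)
      ultimately have kB: "\<kappa> j = Suc (card (U ` B))" using finB by (simp add: \<kappa>_def)
      show ?thesis
      proof (cases "B = {}")
        case True
        then have "Suc (\<tau> 0) = \<tau> x" using tx kB rho_1 mn by (simp add: \<tau>_def)
        then show ?thesis using mn by (intro exI[of _ 0]) simp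
      next
        case False
        then have "Max (U ` B) \<in> U ` B" using finB by (intro Max_in) auto
        then obtain k where k: "k \<in> B" "U k = Max (U ` B)" by auto
        then have kmax: "\<And>j'. j' \<in> B \<Longrightarrow> U j' \<le> U k" using finB by simp
        have kn: "k \<in> {1..n}" "U k < U j" using k by (auto simp: B_def)
        have "B \<subseteq> below k" using kmax by (auto simp: B_def below_def)
        then have "card (U ` B) \<le> \<kappa> k" unfolding \<kappa>_def using fin by (intro card_mono image_mono) auto
        have "\<not> {i \<in> {1..m}. T i j = 1} \<subseteq> {i \<in> {1..m}. T i k = 1}"
          using kn(2) card_mono[of "{i \<in> {1..m}. T i k = 1}" "{i \<in> {1..m}. T i j = 1}"]
          by (auto simp: U_def)
        then obtain i where i: "i \<in> {1..m}" "T i j = 1" "T i k \<noteq> 1" by blast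
        then have "\<kappa> k \<le> \<rho> i" "\<not> \<kappa> j \<le> \<rho> i"
          using key[OF i(1) kn(1)] key[OF i(1) j] bin[of i k] bin[of i j] by auto
        then have "\<rho> i = card (U ` B)" using kB \<open>card (U ` B) \<le> \<kappa> k\<close> by simp
        then have "Suc (\<tau> (i - 1)) = \<tau> x" using tx kB tau_row[OF i(1)] by simp
        moreover have "i - 1 < m + n" using i by auto
        ultimately show ?thesis by blast
      qed
    qed
  qed
  ultimately show ?thesis by blast
qed

section \<open>Existence, uniqueness and bijectivity\<close>

lemma MEW_LPara_unique:
  assumes M: "(T, a) \<in> MEW m n" and mn: "1 \<le> m" "1 \<le> n"
  shows "\<exists>!D. D \<in> LPara m n \<and> bounce_labelled m n D = phi m n T \<and> surp m n D = zeta m n (T, a)"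
proof -
  have "T \<in> EW m n" and a: "\<And>x. x \<in> {1..m+n-1} \<Longrightarrow> 0 \<le> a x \<and> a x \<le> int (eta m n T x) - 1"
    using M unfolding MEW_def by auto
  then obtain \<tau> where "layering m n \<tau>" and T: "T = ew_tableau m n \<tau>" using EW_layering mn by blast
  interpret L: layering m n \<tau> by fact
  \<comment> \<open>The bound on the marks makes \<open>zeta\<close> nonnegative, so
    \<open>nat\<close> loses nothing; the value 0 at label 0 is what \<open>admissible\<close>
    requires.\<close>
  define s where "s x = (if x \<in> {1..m+n-1} then nat (zeta m n (T, a) x) else 0)" for x
  have z: "zeta m n (T, a) x = int (s x) \<and> s x < layer (m + n) \<tau> x" if x: "x \<in> {1..m+n-1}" for x
  proof -
    have "eta m n T x = layer (m + n) \<tau> x" using L.eta_eq_layer[of x] x mn by (auto simp: T)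
    then show ?thesis using a[OF x] x by (auto simp: s_def zeta_def)
  qed
  have adm: "L.admissible s"
    unfolding L.admissible_def
  proof (intro conjI allI impI)
    show "s 0 = 0" by (simp add: s_def)
    fix x assume "x < m + n" "x \<noteq> 0"
    then have "x \<in> {1..m+n-1}" by auto
    then show "s x < layer (m + n) \<tau> x" using z by blast
  qed
  have zs: "zeta m n (T, a) = (\<lambda>x\<in>{1..m+n-1}. int (s x))"
    using z by (intro ext) (auto simp: zeta_def restrict_def)
  show ?thesis
  proof (rule ex1I[of _ "assemble m n (L.F s)"])
    show "assemble m n (L.F s) \<in> LPara m n \<and>
        bounce_labelled m n (assemble m n (L.F s)) = phi m n T \<and>
        surp m n (assemble m n (L.F s)) = zeta m n (T, a)"
      using L.assemble_in_LPara[OF adm] L.bounce_labelled_F[OF adm] L.surp_F[OF adm] zs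
      by (simp add: T L.phi_ew_tableau)
  next
    fix D assume D: "D \<in> LPara m n \<and> bounce_labelled m n D = phi m n T \<and> surp m n D = zeta m n (T, a)"
    then obtain \<tau>' s' where L': "layering m n \<tau>'" and adm': "layering.admissible m n \<tau>' s'"
      and D': "D = assemble m n (layering.F m n \<tau>' s')" using LPara_layering mn by blast
    interpret L': layering m n \<tau>' by fact
    \<comment> \<open>The bounce forgets the surplus, so the levels are compared through
      zero-surplus positions; the surpluses are compared afterwards through
      \<open>surp\<close>.\<close>
    have eq: "\<tau>' x = \<tau> x" if x: "x < m + n" for x
    proof (rule layering_unique[OF L' \<open>layering m n \<tau>\<close> L'.admissible_0 L.admissible_0 _ x])
      have "assemble m n L'.F0 = assemble m n L.F0"
        using D by (simp add: D' L'.bounce_labelled_F[OF adm'] T L.phi_ew_tableau)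
      then show "L'.F0 y = L.F0 y" if "y < m + n" for y
        using that L.leftmost_at_label_F[OF L.admissible_0, of y] L'.leftmost_at_label_F[OF L'.admissible_0, of y]
          L.topmost_at_label_F[OF L.admissible_0, of y] L'.topmost_at_label_F[OF L'.admissible_0, of y]
        by (cases "y < m") simp_all
    qed
    have s: "s' x = s x" if x: "x < m + n" for x
    proof (cases "x = 0")
      case True
      then show ?thesis using adm adm' by (simp add: L.admissible_def L'.admissible_def)
    next
      case False
      then have x': "x \<in> {1..m+n-1}" using x by auto
      have "(\<lambda>x\<in>{1..m+n-1}. int (s' x)) = (\<lambda>x\<in>{1..m+n-1}. int (s x))"
        using D zs by (simp add: D' L'.surp_F[OF adm'])
      from fun_cong[OF this, of x] show ?thesis using x' by simp
    qed
    have cnt: "L'.cnt t = L.cnt t" for t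
      unfolding L.cnt_def L'.cnt_def using eq by (intro arg_cong[of _ _ card] Collect_cong) auto
    show "D = assemble m n (L.F s)"
      unfolding D' using eq s cnt by (intro assemble_cong) (simp add: L.F_def L'.F_def)
  qed
qed

text \<open>The ribbon determines the levels and hence the tableau; then \<open>eta\<close> is known
  and \<open>zeta\<close> determines the marks.\<close>

lemma MEW_determined:
  assumes M: "(T, a) \<in> MEW m n" "(T', a') \<in> MEW m n" and mn: "1 \<le> m" "1 \<le> n"
    and phi: "phi m n T = phi m n T'" and zeta: "zeta m n (T, a) = zeta m n (T', a')"
  shows "(T, a) = (T', a')"
proof -
  have "T \<in> EW m n" "T' \<in> EW m n" and extl: "a \<in> extensional {1..m+n-1}" "a' \<in> extensional {1..m+n-1}"
    using M unfolding MEW_def by auto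
  then obtain \<tau> \<tau>' where L: "layering m n \<tau>" and T: "T = ew_tableau m n \<tau>"
    and L': "layering m n \<tau>'" and T': "T' = ew_tableau m n \<tau>'" using EW_layering mn by meson
  interpret L: layering m n \<tau> by fact
  interpret L': layering m n \<tau>' by fact
  have eq: "\<tau>' x = \<tau> x" if x: "x < m + n" for x
  proof (rule layering_unique[OF L' L L'.admissible_0 L.admissible_0 _ x])
    have "assemble m n L'.F0 = assemble m n L.F0"
      using phi by (simp add: T T' L.phi_ew_tableau L'.phi_ew_tableau)
    then show "L'.F0 y = L.F0 y" if "y < m + n" for y
      using that L.leftmost_at_label_F[OF L.admissible_0, of y] L'.leftmost_at_label_F[OF L'.admissible_0, of y]
        L.topmost_at_label_F[OF L.admissible_0, of y] L'.topmost_at_label_F[OF L'.admissible_0, of y]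
      by (cases "y < m") simp_all
  qed
  have TT: "T = T'"
  proof (intro ext)
    fix i j
    have "of_bool (i \<in> {1..m} \<and> j \<in> {1..n} \<and> \<tau> (i - 1) < \<tau> (j + m - 1)) =
        (of_bool (i \<in> {1..m} \<and> j \<in> {1..n} \<and> \<tau>' (i - 1) < \<tau>' (j + m - 1)) :: nat)"
      using eq[of "i - 1"] eq[of "j + m - 1"] by (cases "i \<in> {1..m} \<and> j \<in> {1..n}") auto
    then show "T i j = T' i j" by (simp add: T T' ew_tableau_def)
  qed
  have "a x = a' x" if "x \<in> {1..m+n-1}" for x
    using fun_cong[OF zeta, of x] that TT by (simp add: zeta_def)
  then have "a = a'" using extl by (intro extensionalityI)
  then show ?thesis using TT by simp
qed

text \<open>Level and surplus of \<open>D\<close> come from burning; the mark is obtained by solving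
  the definition of \<open>zeta\<close> for \<open>a\<close>.\<close>

lemma LPara_MEW:
  assumes D: "D \<in> LPara m n" and mn: "1 \<le> m" "1 \<le> n"
  shows "\<exists>(T, a)\<in>MEW m n. bounce_labelled m n D = phi m n T \<and> surp m n D = zeta m n (T, a)"
proof -
  obtain \<tau> s where "layering m n \<tau>" and adm: "layering.admissible m n \<tau> s"
    and D': "D = assemble m n (layering.F m n \<tau> s)" using LPara_layering[OF assms] by blast
  interpret L: layering m n \<tau> by fact
  let ?T = "ew_tableau m n \<tau>"
  define a where "a = (\<lambda>x\<in>{1..m+n-1}. int (eta m n ?T x) - int (s x) - 1)"
  have lt: "s x < eta m n ?T x" if "x \<in> {1..m+n-1}" for x
  proof -
    have "x < m + n" "x \<noteq> 0" using that mn by auto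
    then show ?thesis using adm L.eta_eq_layer by (simp add: L.admissible_def)
  qed
  then have "(?T, a) \<in> MEW m n"
    using L.ew_tableau_EW by (auto simp: MEW_def a_def simp flip: zless_iff_Suc_zadd)
  moreover have "surp m n D = zeta m n (?T, a)"
    unfolding D' L.surp_F[OF adm] by (auto simp: zeta_def a_def restrict_def)
  moreover have "bounce_labelled m n D = phi m n ?T"
    by (simp add: D' L.bounce_labelled_F[OF adm] L.phi_ew_tableau)
  ultimately show ?thesis by blast
qed

theorem theorem4p6:
  fixes m n :: nat
  assumes "m \<ge> 1" and "n \<ge> 1"
  shows "(\<forall>(T, a)\<in>MEW m n. \<exists>!D. D \<in> LPara m n \<and>
            bounce_labelled m n D = phi m n T \<and> surp m n D = zeta m n (T, a)) \<and>
         bij_betw (Phi m n) (MEW m n) (LPara m n)"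
proof
  let ?rel = "\<lambda>T a D. D \<in> LPara m n \<and> bounce_labelled m n D = phi m n T \<and> surp m n D = zeta m n (T, a)"
  have ex1: "\<exists>!D. ?rel T a D" if "(T, a) \<in> MEW m n" for T a
    using MEW_LPara_unique[OF that assms] .
  then show "\<forall>(T, a)\<in>MEW m n. \<exists>!D. ?rel T a D" by blast
  have Phi: "?rel T a (Phi m n (T, a))" if "(T, a) \<in> MEW m n" for T a
    unfolding Phi_def fst_conv by (rule theI'[OF ex1[OF that]])
  show "bij_betw (Phi m n) (MEW m n) (LPara m n)"
    unfolding bij_betw_def
  proof
    show "inj_on (Phi m n) (MEW m n)"
    proof (rule inj_onI)
      fix M M' assume M: "M \<in> MEW m n" "M' \<in> MEW m n" "Phi m n M = Phi m n M'"
      obtain T a T' a' where MM: "M = (T, a)" "M' = (T', a')" by (cases M, cases M')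
      then have "phi m n T = phi m n T'" "zeta m n (T, a) = zeta m n (T', a')"
        using Phi[of T a] Phi[of T' a'] M by simp_all
      then show "M = M'" using MEW_determined assms M MM by blast
    qed
    show "Phi m n ` MEW m n = LPara m n"
    proof (intro equalityI subsetI)
      fix D assume "D \<in> Phi m n ` MEW m n"
      then show "D \<in> LPara m n" using Phi by auto
    next
      fix D assume D: "D \<in> LPara m n"
      then obtain T a where M: "(T, a) \<in> MEW m n" and "?rel T a D" using LPara_MEW assms by blast
      then have "Phi m n (T, a) = D" using ex1[OF M] Phi[OF M] by blast
      then show "D \<in> Phi m n ` MEW m n" using M by blast
    qed
  qed
qed

end
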